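(* Let $k\in\mathrm{Pos}^s_\nu$. For strictly positive scalars $\alpha,\beta$, consider the nonlinear semidefinite program $$({\rm SDP}_{\alpha,\beta})\qquad \min\ G_k(P)\quad\text{s.t.}\quad P\in C_{\alpha,\beta}.$$ Let $\alpha,\beta>0$ be such that $({\rm SDP}_{\alpha,\beta})$ is feasible. Then: 1. $({\rm SDP}_{\alpha,\beta})$ admits an optimal solution $P^{\alpha,\beta}$; 2. for all $0<\varepsilon<\varepsilon_k(P^{\alpha,\beta})$, all $\varepsilon$-optimal solutions $P_\varepsilon^{\alpha,\beta}$ of $({\rm SDP}_{\alpha,\beta})$ satisfy $$\mathbf{K}^{\rm lyap}_\nu\left(k,P_\varepsilon^{\alpha,\beta},t_Q^*(P_\varepsilon^{\alpha,\beta})\right)=\mathbf{K}^{\rm lyap}_\nu\left(k,P^{\alpha,\beta},t_Q^*(P^{\alpha,\beta})\right).$$ Moreover, for all $\beta>0$, there exists $\alpha\in(0,a(\beta)]$ such that (with $P^{\alpha,\beta}$ an optimal solution of $({\rm SDP}_{\alpha,\beta})$) $$\mathbf{K}^{\rm lyap}_\nu\left(k,P^{\alpha,\beta},t_Q^*(P^{\alpha,\beta})\right)=\min_{P\in\mathcal{L}_A}\mathbf{K}^{\rm lyap}_\nu\left(k,P,t_Q^*(P)\right).$$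
   Context: Data: $d\geq 1$, $A\in\mathbb{R}^{d\times d}$, $Q\in\mathbb{R}^{d\times d}$ symmetric, $q\in\mathbb{R}^d$, and $X^{\rm in}\subset\mathbb{R}^d$ a nonempty polytope (bounded). Standing assumptions: $0<\rho(A)<1$ ($\rho$ = spectral radius); $X^{\rm in}\neq\{0\}$; if $Q\preceq 0$ then $q\neq 0$. $\mathbb{N}$ contains $0$, $\mathbb{R}_+=[0,+\infty)$. For $k\in\mathbb{N}$, $\nu_k:=\max_{x\in X^{\rm in}}\left(x^\intercal (A^k)^\intercal Q A^k x+q^\intercal A^k x\right)$, and $\mathrm{Pos}^s_\nu:=\{k\in\mathbb{N}:\nu_k>0\}$. For Hermitian matrices, $B\succ0$ (resp. $B\succeq 0$) means positive definite (resp. semidefinite). $\mathcal{L}_A:=\{P\in\mathbb{C}^{d\times d}\text{ Hermitian}: P\succ 0,\ P-A^\intercal PA\succ 0\}$. For $P\succ 0$: $\|x\|_P:=\sqrt{x^*Px}$ on $\mathbb{C}^d$, $\|A\|_P:=\max_{x\neq0}\|Ax\|_P/\|x\|_P$, $\|y\|_P^*:=\sqrt{y^*P^{-1}y}$, $\mu(P):=\max_{x\in X^{\rm in}}x^\intercal Px$, $\mathcal{T}_Q(P):=\{t\in\mathbb{R}_+: tP-Q\succeq0\}$, and $t_Q^*(P):=\max\{\lambda_{\max}(P^{-1/2}QP^{-1/2}),0\}$ (the smallest element of $\mathcal{T}_Q(P)$). Let $\mathcal{L}(A,Q):=\{(P,t): P\in\mathcal{L}_A,\ t\in\mathcal{T}_Q(P)\}$.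 For $(P,t)\in\mathcal{L}(A,Q)$ and $x\in\mathbb{R}_+$, $H_{P,t}(x):=x\sqrt{\mu(P)}\,\|q\|_P^*$ if $t=0$, and $H_{P,t}(x):=\left(\sqrt{t\mu(P)}\,x+\frac{\|q\|_P^*}{2\sqrt t}\right)^2-\frac{(\|q\|_P^* )^2}{4t}$ if $t>0$. It is a strictly increasing homeomorphism of $\mathbb{R}_+$, with inverse $H_{P,t}^{-1}$. Standing assumption: $\nu_0<H_{P,t}(1)$ for all $(P,t)\in\mathcal{L}(A,Q)$. For $k\in\mathrm{Pos}^s_\nu$ and $(P,t)\in\mathcal{L}(A,Q)$: $\mathbf{K}^{\rm lyap}_\nu(k,P,t):=\left\lfloor \frac{\ln\left(H_{P,t}^{-1}(\nu_k)\right)}{\ln\|A\|_P}\right\rfloor+1$. For $P\in\mathcal{L}_A$: $G_k(P):=\frac{\ln\left(H^{-1}_{P,t_Q^*(P)}(\nu_k)\right)}{\ln\|A\|_P}$ and $\varepsilon_k(P):=\lfloor G_k(P)\rfloor+1-G_k(P)$. For $\alpha,\beta>0$: $C_{\alpha,\beta}:=\{P\text{ Hermitian},\ P\succeq0 : P-A^\intercal PA\succeq\alpha\,\mathrm{Id}\text{ and }P\preceq\beta\,\mathrm{Id}\}$. $R_I$ is the unique positive definite matrix with $R_I-(A^\intercal)^dR_IA^d=\mathrm{Id}$, and $a(\beta):=\dfrac{\beta}{\lambda_{\max}\left(\sum_{j=0}^{d-1}(A^\intercal)^jA^j\right)\lambda_{\max}(R_I)}$. An $\varepsilon$-optimal solution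 of $({\rm SDP}_{\alpha,\beta})$ is a feasible $P$ with $G_k(P)\leq\inf_{C_{\alpha,\beta}}G_k+\varepsilon$. *)

theory Defs
  imports "HOL-Analysis.Analysis"
begin

section \<open>Complex matrices\<close>

abbreviation cmat :: "real^'n^'m \<Rightarrow> complex^'n^'m" where
  "cmat \<equiv> map_matrix complex_of_real"

definition cvec :: "real^'n \<Rightarrow> complex^'n" where
  "cvec x = (\<chi> i. complex_of_real (x $ i))"

text \<open>The operator \<open>^\<close> on \<open>'a^'n^'n\<close> is the entrywise power, hence a separate matrix power.\<close>

primrec matpow :: "'a::semiring_1^'n^'n \<Rightarrow> nat \<Rightarrow> 'a^'n^'n" where
  "matpow M 0 = mat 1"
| "matpow M (Suc k) = M ** matpow M k"

definition hermitian :: "complex^'n^'n \<Rightarrow> bool" where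
  "hermitian M \<longleftrightarrow> (\<forall>i j. M $ i $ j = cnj (M $ j $ i))"

text \<open>\<open>quadform M x\<close> is \<open>x\<^sup>* M x\<close>; this number is real when \<open>M\<close> is Hermitian, which is the
  only case in which the real part is used below.\<close>

definition quadform :: "complex^'n^'n \<Rightarrow> complex^'n \<Rightarrow> real" where
  "quadform M x = Re (\<Sum>i\<in>UNIV. cnj (x $ i) * (M *v x) $ i)"

definition psd :: "complex^'n^'n \<Rightarrow> bool" where
  "psd M \<longleftrightarrow> hermitian M \<and> (\<forall>x. 0 \<le> quadform M x)"

definition pd :: "complex^'n^'n \<Rightarrow> bool" where
  "pd M \<longleftrightarrow> hermitian M \<and> (\<forall>x. x \<noteq> 0 \<longrightarrow> 0 < quadform M x)"

definition eigvals :: "complex^'n^'n \<Rightarrow> complex set" where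
  "eigvals M = {l. \<exists>v. v \<noteq> 0 \<and> M *v v = l *s v}"

text \<open>\<open>eigvals M\<close> is finite and nonempty, and consists of real numbers if \<open>M\<close> is Hermitian.\<close>

definition spec_radius :: "real^'n^'n \<Rightarrow> real" where
  "spec_radius A = Max (cmod ` eigvals (cmat A))"

definition lambda_max :: "complex^'n^'n \<Rightarrow> real" where
  "lambda_max M = Max (Re ` eigvals M)"

text \<open>\<open>P\<close> to the power \<open>-1/2\<close>: the positive definite square root of the inverse of a positive
  definite \<open>P\<close>.\<close>

definition inv_sqrt :: "complex^'n^'n \<Rightarrow> complex^'n^'n" where
  "inv_sqrt P = (THE S. pd S \<and> S ** S = matrix_inv P)"


section \<open>The maximization problems and the Lyapunov data\<close>

text \<open>Suprema written \<open>SUP\<close> below are attained maxima: \<open>X\<close> is a nonempty polytope, and the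
  quotient defining the matrix norm is continuous and homogeneous of degree 0.\<close>

definition nu :: "real^'n^'n \<Rightarrow> real^'n^'n \<Rightarrow> real^'n \<Rightarrow> (real^'n) set \<Rightarrow> nat \<Rightarrow> real" where
  "nu A Q q X k =
     (SUP x\<in>X. x \<bullet> ((transpose (matpow A k) ** Q ** matpow A k) *v x) + q \<bullet> (matpow A k *v x))"

definition Pos_nu :: "real^'n^'n \<Rightarrow> real^'n^'n \<Rightarrow> real^'n \<Rightarrow> (real^'n) set \<Rightarrow> nat set" where
  "Pos_nu A Q q X = {k. nu A Q q X k > 0}"

definition lyap :: "real^'n^'n \<Rightarrow> (complex^'n^'n) set" where
  "lyap A = {P. hermitian P \<and> pd P \<and> pd (P - transpose (cmat A) ** P ** cmat A)}"

definition norm_P :: "complex^'n^'n \<Rightarrow> complex^'n \<Rightarrow> real" where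
  "norm_P P x = sqrt (quadform P x)"

definition matnorm_P :: "complex^'n^'n \<Rightarrow> real^'n^'n \<Rightarrow> real" where
  "matnorm_P P A = (SUP x\<in>{x. x \<noteq> 0}. norm_P P (cmat A *v x) / norm_P P x)"

definition dual_norm_P :: "complex^'n^'n \<Rightarrow> complex^'n \<Rightarrow> real" where
  "dual_norm_P P y = sqrt (quadform (matrix_inv P) y)"

definition mu :: "(real^'n) set \<Rightarrow> complex^'n^'n \<Rightarrow> real" where
  "mu X P = (SUP x\<in>X. quadform P (cvec x))"

definition T_set :: "real^'n^'n \<Rightarrow> complex^'n^'n \<Rightarrow> real set" where
  "T_set Q P = {t. 0 \<le> t \<and> psd (t *\<^sub>R P - cmat Q)}"

definition t_star :: "real^'n^'n \<Rightarrow> complex^'n^'n \<Rightarrow> real" where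
  "t_star Q P = max (lambda_max (inv_sqrt P ** cmat Q ** inv_sqrt P)) 0"

definition lyap_pairs :: "real^'n^'n \<Rightarrow> real^'n^'n \<Rightarrow> ((complex^'n^'n) \<times> real) set" where
  "lyap_pairs A Q = {(P, t). P \<in> lyap A \<and> t \<in> T_set Q P}"

definition H :: "real^'n \<Rightarrow> (real^'n) set \<Rightarrow> complex^'n^'n \<Rightarrow> real \<Rightarrow> real \<Rightarrow> real" where
  "H q X P t x =
     (if t = 0 then x * sqrt (mu X P) * dual_norm_P P (cvec q)
      else (sqrt (t * mu X P) * x + dual_norm_P P (cvec q) / (2 * sqrt t))\<^sup>2
             - (dual_norm_P P (cvec q))\<^sup>2 / (4 * t))"

definition H_inv :: "real^'n \<Rightarrow> (real^'n) set \<Rightarrow> complex^'n^'n \<Rightarrow> real \<Rightarrow> real \<Rightarrow> real" where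
  "H_inv q X P t = inv_into {0..} (H q X P t)"

definition K_lyap ::
  "real^'n^'n \<Rightarrow> real^'n^'n \<Rightarrow> real^'n \<Rightarrow> (real^'n) set \<Rightarrow> nat \<Rightarrow> complex^'n^'n \<Rightarrow> real \<Rightarrow> int" where
  "K_lyap A Q q X k P t = \<lfloor>ln (H_inv q X P t (nu A Q q X k)) / ln (matnorm_P P A)\<rfloor> + 1"

definition G ::
  "real^'n^'n \<Rightarrow> real^'n^'n \<Rightarrow> real^'n \<Rightarrow> (real^'n) set \<Rightarrow> nat \<Rightarrow> complex^'n^'n \<Rightarrow> real" where
  "G A Q q X k P = ln (H_inv q X P (t_star Q P) (nu A Q q X k)) / ln (matnorm_P P A)"

definition eps_G ::
  "real^'n^'n \<Rightarrow> real^'n^'n \<Rightarrow> real^'n \<Rightarrow> (real^'n) set \<Rightarrow> nat \<Rightarrow> complex^'n^'n \<Rightarrow> real" where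
  "eps_G A Q q X k P = of_int \<lfloor>G A Q q X k P\<rfloor> + 1 - G A Q q X k P"


section \<open>The semidefinite program\<close>

definition C_set :: "real^'n^'n \<Rightarrow> real \<Rightarrow> real \<Rightarrow> (complex^'n^'n) set" where
  "C_set A \<alpha> \<beta> =
     {P. hermitian P \<and> psd P \<and> psd (P - transpose (cmat A) ** P ** cmat A - \<alpha> *\<^sub>R mat 1)
       \<and> psd (\<beta> *\<^sub>R mat 1 - P)}"

definition sdp_optimal ::
  "real^'n^'n \<Rightarrow> real^'n^'n \<Rightarrow> real^'n \<Rightarrow> (real^'n) set \<Rightarrow> nat \<Rightarrow> real \<Rightarrow> real \<Rightarrow> complex^'n^'n \<Rightarrow> bool"
  where "sdp_optimal A Q q X k \<alpha> \<beta> P \<longleftrightarrow> is_arg_min (G A Q q X k) (\<lambda>P. P \<in> C_set A \<alpha> \<beta>) P"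

definition sdp_eps_optimal ::
  "real^'n^'n \<Rightarrow> real^'n^'n \<Rightarrow> real^'n \<Rightarrow> (real^'n) set \<Rightarrow> nat \<Rightarrow> real \<Rightarrow> real \<Rightarrow> real \<Rightarrow> complex^'n^'n \<Rightarrow> bool"
  where "sdp_eps_optimal A Q q X k \<alpha> \<beta> \<epsilon> P \<longleftrightarrow>
    P \<in> C_set A \<alpha> \<beta> \<and> G A Q q X k P \<le> (INF P'\<in>C_set A \<alpha> \<beta>. G A Q q X k P') + \<epsilon>"

definition R_I :: "real^'n^'n \<Rightarrow> complex^'n^'n" where
  "R_I A = (THE R. pd R \<and>
     R - matpow (transpose (cmat A)) CARD('n) ** R ** matpow (cmat A) CARD('n) = mat 1)"

definition a_bound :: "real^'n^'n \<Rightarrow> real \<Rightarrow> real" where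
  "a_bound A \<beta> =
     \<beta> / (lambda_max (\<Sum>j<CARD('n). matpow (transpose (cmat A)) j ** matpow (cmat A) j)
          * lambda_max (R_I A))"

end

theory Submission
  imports Defs "HOL-Computational_Algebra.Fundamental_Theorem_Algebra"
begin

text \<open>The argument rests on three facts about the objective \<^term>\<open>G A Q q X k\<close> on \<^term>\<open>lyap A\<close>: it is
continuous, positive, and invariant under \<open>P \<mapsto> c P\<close> with \<open>c > 0\<close>.

Continuity makes the semidefinite program solvable. For \<open>\<alpha> > 0\<close> the feasible set is a compact
subset of \<^term>\<open>lyap A\<close> (\<open>compact_C_set\<close>, \<open>C_set_subset_lyap\<close>), so \<open>G\<close> attains its minimum there
(\<open>sdp_has_optimal_solution\<close>). The statement on \<open>\<epsilon>\<close>-optimal solutions is then arithmetic, because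
\<open>K_lyap\<close> at \<open>t_star\<close> is \<open>\<lfloor>G\<rfloor> + 1\<close>, and a perturbation of \<open>G\<close> that stays below the next integer
does not change the floor.

Positivity and invariance give the last claim. By positivity the integers \<open>\<lfloor>G P\<rfloor> + 1\<close> are bounded
below, hence some \<open>P\<^sub>0\<close> in \<^term>\<open>lyap A\<close> realizes the least of them. A small multiple \<open>c P\<^sub>0\<close> lies
below \<open>\<beta> I\<close>, and it is feasible for every sufficiently small \<open>\<alpha>\<close>, in particular for one below the
positive number \<^term>\<open>a_bound A \<beta>\<close> (\<open>lyap_scaled_feasible\<close>, \<open>a_bound_pos\<close>). As \<open>G (c P\<^sub>0) = G P\<^sub>0\<close>,
an optimal solution for this \<open>\<alpha>\<close> has a value of \<open>G\<close> at most \<open>G P\<^sub>0\<close>, hence the least integer bound.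

Continuity and invariance of \<open>G\<close> come from one device. Each of \<open>mu\<close>, \<open>matnorm_P\<close>, \<open>dual_norm_P\<close> and
\<open>t_star\<close> is expressed as a supremum, over the unit sphere or over \<open>X\<close>, of an explicit function that
is jointly continuous in \<open>P\<close> and the vector; such a supremum over a compact set is continuous in \<open>P\<close>
(\<open>continuous_on_SUP_compact\<close>). The inverse of \<open>H\<close> has the closed form
\<open>2 \<nu> / (\<surd>\<mu> (\<surd>(4 t \<nu> + D\<^sup>2) + D))\<close>, where \<open>D\<close> is the dual norm of \<open>q\<close>; it is valid for \<open>t = 0\<close> and
\<open>t > 0\<close> alike (\<open>H_inv_eq\<close>). Positivity of \<open>G\<close> means that \<open>H_inv\<close> maps \<open>\<nu>\<^sub>k\<close> into \<open>(0, 1)\<close>, that is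
\<open>\<nu>\<^sub>k < H 1\<close>: for \<open>k = 0\<close> this is the standing assumption, and for \<open>k \<ge> 1\<close> it follows from
\<open>\<nu>\<^sub>k \<le> H \<parallel>A\<parallel>\<^sub>P\<close> and \<open>\<parallel>A\<parallel>\<^sub>P < 1\<close> (\<open>nu_le_H_matnorm\<close>).

The remaining work is linear algebra needed to interpret the definitions. The largest eigenvalue of
a Hermitian matrix is the maximum of its form on the unit sphere (\<open>lambda_max_attained\<close>), a positive definite
matrix has exactly one positive definite square root (\<open>inv_sqrt_properties\<close>), and a spectral radius
below 1 forces all orbits \<open>A\<^sup>k v\<close> to 0 (\<open>matpow_orbit_tendsto_0\<close>), which makes the Stein equation
\<open>R - C\<^sup>T R C = I\<close> uniquely solvable by a positive definite \<open>R\<close>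
(\<open>stein_equation_unique_solution\<close>).\<close>

section \<open>Hermitian matrices as self-adjoint operators on a real inner product space\<close>

text \<open>The type \<open>complex^'n\<close> carries the real inner product \<open>Re (x\<^sup>* y)\<close>. All quadratic forms and adjoints
below are treated in this real Euclidean space, where transposed real matrices are adjoints and
Hermitian matrices are self-adjoint operators.\<close>

lemma quadform_inner: "quadform M x = x \<bullet> (M *v x)"
  by (simp add: quadform_def inner_vec_def inner_complex_def)

lemma matrix_scaleR_vector: "(c *\<^sub>R M) *v x = c *\<^sub>R (M *v (x::complex^'n))"
  by (simp add: vec_eq_iff matrix_vector_mult_def scaleR_sum_right)

lemma matrix_vector_scaleR: "M *v (c *\<^sub>R x) = c *\<^sub>R (M *v (x::complex^'n))"
  by (simp add: vec_eq_iff matrix_vector_mult_def scaleR_sum_right)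

lemma scaleR_eq_scalar_mult: "c *\<^sub>R (x::complex^'n) = complex_of_real c *s x"
  unfolding vec_eq_iff vector_scaleR_component vector_smult_component
  by (simp add: scaleR_conv_of_real)

lemma inner_scalar_mult_self: "(v::complex^'n) \<bullet> (l *s v) = Re l * (norm v)\<^sup>2"
  unfolding power2_norm_eq_inner
  by (simp add: inner_vec_def inner_complex_def algebra_simps sum_distrib_left)

lemma norm_scalar_mult: "norm (c *s (y::complex^'n)) = cmod c * norm y"
  by (simp add: norm_vec_def L2_set_right_distrib norm_mult)

lemma inner_axis_entry:
  fixes M :: "complex^'n^'n"
  shows "axis i 1 \<bullet> (M *v axis j 1) = Re (M $ i $ j)" 
    "axis i \<i> \<bullet> (M *v axis j 1) = Im (M $ i $ j)"
    "(M *v axis i 1) \<bullet> axis j 1 = Re (M $ j $ i)" 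
    "(M *v axis i \<i>) \<bullet> axis j 1 = - Im (M $ j $ i)"
proof -
  have *: "(M *v axis k c) = (\<chi> l. M $ l $ k * c)" for k c
    by (simp add: vec_eq_iff matrix_vector_mult_def axis_def if_distrib cong: if_cong)
  show "axis i 1 \<bullet> (M *v axis j 1) = Re (M $ i $ j)" 
    "axis i \<i> \<bullet> (M *v axis j 1) = Im (M $ i $ j)"
    "(M *v axis i 1) \<bullet> axis j 1 = Re (M $ j $ i)" 
    "(M *v axis i \<i>) \<bullet> axis j 1 = - Im (M $ j $ i)"
    by (simp_all add: inner_axis inner_axis' * inner_complex_def)
qed

lemma inner_adjoint:
  fixes M :: "complex^'n^'m"
  shows "x \<bullet> (M *v y) = ((\<chi> i j. cnj (M $ j $ i)) *v x) \<bullet> y"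
proof -
  have *: "x \<bullet> y = Re (\<Sum>i\<in>UNIV. cnj (x $ i) * y $ i)" for x y :: "complex^'k"
    by (simp add: inner_vec_def inner_complex_def)
  have "x \<bullet> (M *v y) = Re (\<Sum>i\<in>UNIV. \<Sum>j\<in>UNIV. cnj (x $ i) * (M $ i $ j * y $ j))"
    unfolding * by (simp add: matrix_vector_mult_def sum_distrib_left del: Re_sum)
  also have "\<dots> = Re (\<Sum>j\<in>UNIV. \<Sum>i\<in>UNIV. cnj (cnj (M $ i $ j) * x $ i) * y $ j)"
    by (subst sum.swap) (simp add: mult_ac del: Re_sum)
  also have "\<dots> = ((\<chi> i j. cnj (M $ j $ i)) *v x) \<bullet> y"
    unfolding * by (simp add: matrix_vector_mult_def sum_distrib_right del: Re_sum)
  finally show ?thesis .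
qed

text \<open>Self-adjointness for the real inner product already forces the matrix to be Hermitian: testing with
\<open>e\<^sub>i\<close> and \<open>\<i> e\<^sub>i\<close> against \<open>e\<^sub>j\<close> recovers the real and imaginary parts of the entries.\<close>

lemma hermitian_iff_self_adjoint:
  "hermitian M \<longleftrightarrow> (\<forall>x y. x \<bullet> (M *v y) = (M *v x) \<bullet> y)"
proof
  assume "hermitian M"
  then have "(\<chi> i j. cnj (M $ j $ i)) = M"
    by (metis (mono_tags, lifting) hermitian_def vec_lambda_unique)
  then show "\<forall>x y. x \<bullet> (M *v y) = (M *v x) \<bullet> y"
    by (simp add: inner_adjoint)
next
  assume *: "\<forall>x y. x \<bullet> (M *v y) = (M *v x) \<bullet> y"
  show "hermitian M"
    unfolding hermitian_def
  proof (intro allI complex_eqI)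
    fix i j
    show "Re (M $ i $ j) = Re (cnj (M $ j $ i))"
      using *[rule_format, of "axis i 1" "axis j 1"] by (simp add: inner_axis_entry)
    show "Im (M $ i $ j) = Im (cnj (M $ j $ i))"
      using *[rule_format, of "axis i \<i>" "axis j 1"] by (simp add: inner_axis_entry)
  qed
qed

lemma hermitianD: "hermitian M \<Longrightarrow> x \<bullet> (M *v y) = (M *v x) \<bullet> y"
  by (simp add: hermitian_iff_self_adjoint)

lemma cmat_adjoint:
  fixes A :: "real^'n^'m"
  shows "x \<bullet> (transpose (cmat A) *v y) = (cmat A *v x) \<bullet> y"
  unfolding inner_adjoint[of x "transpose (cmat A)" y]
  by (rule arg_cong[where f="\<lambda>M. (M *v x) \<bullet> y"]) (simp add: vec_eq_iff transpose_def)

lemma cmat_matrix_mult: "cmat (A ** B) = cmat A ** cmat (B :: real^'n^'n)" for A :: "real^'n^'n"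
  by (simp add: vec_eq_iff matrix_matrix_mult_def)

lemma cmat_matpow: "cmat (matpow A k) = matpow (cmat A) k"
  by (induction k) (simp_all add: cmat_matrix_mult, simp add: vec_eq_iff mat_def)

lemma cmat_cvec: "cmat A *v cvec x = cvec (A *v x)"
  by (simp add: vec_eq_iff matrix_vector_mult_def cvec_def)

lemma inner_cvec: "cvec x \<bullet> cvec y = x \<bullet> y"
  by (simp add: inner_vec_def cvec_def inner_complex_def)

lemma cvec_eq_0_iff: "cvec x = 0 \<longleftrightarrow> x = 0"
  by (simp add: vec_eq_iff cvec_def)

lemma hermitian_cmat: "transpose Q = Q \<Longrightarrow> hermitian (cmat Q)"
  by (simp add: hermitian_def vec_eq_iff transpose_def)

lemma matpow_commute: "M ** matpow M k = matpow M k ** M"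
proof (induction k)
  case (Suc k)
  have "M ** matpow M (Suc k) = M ** (matpow M k ** M)" by (simp only: matpow.simps Suc)
  then show ?case by (simp only: matrix_mul_assoc matpow.simps)
qed simp

lemma matpow_transpose: "matpow (transpose M) k = transpose (matpow (M::complex^'n^'n) k)"
proof (induction k)
  case (Suc k)
  have "transpose (matpow M (Suc k)) = transpose M ** transpose (matpow M k)"
    by (simp only: matpow.simps matpow_commute matrix_transpose_mul)
  then show ?case by (simp only: matpow.simps Suc)
qed simp

lemma matpow_add: "matpow M (i + j) = matpow M i ** matpow M j"
  by (induction i) (simp_all add: matrix_mul_assoc)

lemma matpow_mult: "matpow M (i * j) = matpow (matpow M i) j"
  by (induction j) (simp_all add: matpow_add)

lemma hermitian_add: "hermitian M \<Longrightarrow> hermitian N \<Longrightarrow> hermitian (M + N)"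
  and hermitian_diff: "hermitian M \<Longrightarrow> hermitian N \<Longrightarrow> hermitian (M - N)"
  and hermitian_scaleR: "hermitian M \<Longrightarrow> hermitian (c *\<^sub>R M)"
  and hermitian_mat_1: "hermitian (mat 1)"
  by (auto simp: hermitian_iff_self_adjoint matrix_vector_mult_add_rdistrib
      matrix_vector_mult_diff_rdistrib inner_add_right inner_diff_right inner_add_left
      inner_diff_left matrix_scaleR_vector)

lemma hermitian_conjugate:
  assumes "hermitian P"
  shows "hermitian (transpose (cmat A) ** P ** cmat A)"
  unfolding hermitian_iff_self_adjoint
proof (intro allI)
  fix x y
  let ?T = "transpose (cmat A)"
  have "x \<bullet> (?T *v (P *v (cmat A *v y))) = (P *v (cmat A *v x)) \<bullet> (cmat A *v y)"
    by (simp only: cmat_adjoint hermitianD[OF assms])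
  also have "\<dots> = (?T *v (P *v (cmat A *v x))) \<bullet> y"
    by (metis cmat_adjoint inner_commute)
  finally show "x \<bullet> ((?T ** P ** cmat A) *v y) = ((?T ** P ** cmat A) *v x) \<bullet> y"
    by (simp only: matrix_vector_mul_assoc matrix_mul_assoc)
qed

lemma quadform_diff: "quadform (M - N) x = quadform M x - quadform N x"
  and quadform_add: "quadform (M + N) x = quadform M x + quadform N x"
  and quadform_scaleR: "quadform (c *\<^sub>R M) x = c * quadform M x"
  and quadform_mat_1: "quadform (mat 1) x = (norm x)\<^sup>2"
  by (simp_all add: quadform_inner matrix_vector_mult_add_rdistrib matrix_vector_mult_diff_rdistrib
      inner_add_right inner_diff_right matrix_scaleR_vector power2_norm_eq_inner)

lemma quadform_minus: "quadform (- M) x = - quadform M x"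
  using quadform_scaleR[of "-1" M x] by simp

lemma quadform_scaleR_vec: "quadform M (c *\<^sub>R x) = c\<^sup>2 * quadform M x"
  by (simp add: quadform_inner matrix_vector_scaleR power2_eq_square)

lemma quadform_conjugate:
  "quadform (transpose (cmat A) ** P ** cmat A) x = quadform P (cmat A *v x)"
  by (simp only: quadform_inner cmat_adjoint matrix_vector_mul_assoc[symmetric])

lemma quadform_sphere: "x \<noteq> 0 \<Longrightarrow> quadform M x = (norm x)\<^sup>2 * quadform M (x /\<^sub>R norm x)"
  by (simp add: quadform_scaleR_vec field_simps)

lemma continuous_on_matrix_vector [continuous_intros]:
  fixes f :: "'a::topological_space \<Rightarrow> complex^'n^'m"
  assumes "continuous_on S f" "continuous_on S g"
  shows "continuous_on S (\<lambda>x. f x *v g x)"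
  unfolding matrix_vector_mult_def
  by (intro continuous_on_vec_lambda continuous_intros continuous_on_component assms)

lemma continuous_on_quadform [continuous_intros]:
  fixes f :: "'a::topological_space \<Rightarrow> complex^'n^'n"
  assumes "continuous_on S f" "continuous_on S g"
  shows "continuous_on S (\<lambda>x. quadform (f x) (g x))"
  unfolding quadform_inner by (intro continuous_intros assms)

lemma pd_imp_psd: "pd M \<Longrightarrow> psd M"
  unfolding pd_def psd_def by (metis inner_zero_left less_eq_real_def quadform_inner)

lemma pd_scaleR: "pd M \<Longrightarrow> 0 < c \<Longrightarrow> pd (c *\<^sub>R M)"
  by (simp add: pd_def quadform_scaleR hermitian_scaleR)

text \<open>The usual discriminant argument, applied to the nonnegative quadratic polynomial
\<open>s \<mapsto> quadform M (x + s y)\<close>.\<close>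

lemma psd_cauchy_schwarz:
  assumes "psd M"
  shows "(x \<bullet> (M *v y))\<^sup>2 \<le> quadform M x * quadform M y"
proof -
  define a b c where "a = quadform M x" and "b = x \<bullet> (M *v y)" and "c = quadform M y"
  have h: "hermitian M" and nn: "\<And>x. 0 \<le> quadform M x"
    using assms by (auto simp: psd_def)
  have eq: "quadform M (x + s *\<^sub>R y) = a + 2 * s * b + s\<^sup>2 * c" for s
    using hermitianD[OF h, of x y]
    by (simp add: a_def b_def c_def quadform_inner matrix_vector_right_distrib matrix_vector_scaleR
        inner_add_left inner_add_right algebra_simps power2_eq_square inner_commute)
  show ?thesis
  proof (cases "c = 0")
    case True
    have "b = 0"
    proof (rule ccontr)
      assume "b \<noteq> 0"
      then show False
        using nn[of "x + (- (a + 1) / (2 * b)) *\<^sub>R y"] eq[of "- (a + 1) / (2 * b)"] True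
        by (simp add: field_simps)
    qed
    then show ?thesis using True by (simp add: b_def c_def)
  next
    case False
    then have c: "c > 0" using nn[of y] by (simp add: c_def)
    have "0 \<le> a + 2 * (- b / c) * b + (- b / c)\<^sup>2 * c"
      using nn eq by metis
    also have "\<dots> = a - b\<^sup>2 / c" using c by (simp add: field_simps power2_eq_square)
    finally have "b\<^sup>2 \<le> a * c" using c by (simp add: field_simps)
    then show ?thesis by (simp add: a_def b_def c_def)
  qed
qed

lemma psd_null_vector:
  assumes "psd M" "quadform M x = 0"
  shows "M *v x = 0"
proof -
  have "((M *v x) \<bullet> (M *v x))\<^sup>2 \<le> 0"
    using psd_cauchy_schwarz[OF assms(1), of "M *v x" x] assms(2) by simp
  then show ?thesis by simp
qed

text \<open>Cauchy--Schwarz with the pair \<open>M x\<close>, \<open>x\<close> turns an upper bound on the quadratic form of a positive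
semidefinite matrix into a bound on its operator norm.\<close>

lemma psd_norm_bound:
  assumes "psd M" and le: "\<And>x. quadform M x \<le> c * (norm x)\<^sup>2"
  shows "norm (M *v x) \<le> c * norm x"
proof (cases "M *v x = 0")
  case True
  have "0 \<le> c \<or> x = 0"
  proof (rule ccontr)
    assume a: "\<not> (0 \<le> c \<or> x = 0)"
    then have "c * (norm x)\<^sup>2 < 0" by (simp add: mult_neg_pos)
    then show False using le[of x] assms(1) by (auto simp: psd_def) (metis leD order.trans)
  qed
  then show ?thesis using True by auto
next
  case False
  let ?y = "M *v x"
  have nn: "\<And>x. 0 \<le> quadform M x" using assms(1) by (auto simp: psd_def)
  have c: "0 \<le> c * (norm x)\<^sup>2" "0 \<le> c * (norm ?y)\<^sup>2" using le nn order.trans by blast+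
  have "((norm ?y)\<^sup>2)\<^sup>2 \<le> quadform M ?y * quadform M x"
    using psd_cauchy_schwarz[OF assms(1), of ?y x] by (simp add: power2_norm_eq_inner)
  also have "\<dots> \<le> (c * (norm ?y)\<^sup>2) * (c * (norm x)\<^sup>2)"
    by (intro mult_mono le nn c)
  finally have "(norm ?y)\<^sup>2 * (norm ?y)\<^sup>2 \<le> (norm ?y)\<^sup>2 * (c * norm x)\<^sup>2"
    by (simp add: power2_eq_square mult_ac)
  moreover have "(norm ?y)\<^sup>2 > 0" using False by simp
  ultimately have "(norm ?y)\<^sup>2 \<le> (c * norm x)\<^sup>2" by (metis mult_le_cancel_left_pos)
  moreover have "0 \<le> c" using c(2) False by (simp add: zero_le_mult_iff)
  ultimately show ?thesis by (simp add: power2_le_iff_abs_le)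
qed

lemma pd_inverse:
  assumes "pd P"
  shows "P ** matrix_inv P = mat 1" "matrix_inv P ** P = mat 1" "pd (matrix_inv P)"
proof -
  have "P *v x = 0 \<longrightarrow> x = 0" for x
    using assms unfolding pd_def by (metis inner_zero_right less_irrefl quadform_inner)
  then have "invertible P"
    by (metis invertible_left_inverse matrix_left_invertible_ker)
  then have "P ** matrix_inv P = mat 1 \<and> matrix_inv P ** P = mat 1"
    unfolding invertible_def matrix_inv_def by (rule someI_ex)
  then show 1: "P ** matrix_inv P = mat 1" and 2: "matrix_inv P ** P = mat 1" by auto
  let ?N = "matrix_inv P"
  have PN: "P *v (?N *v x) = x" for x
    by (simp add: matrix_vector_mul_assoc 1)
  have hP: "hermitian P" using assms by (simp add: pd_def)
  have "x \<bullet> (?N *v y) = (?N *v x) \<bullet> y" for x y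
    using hermitianD[OF hP, of "?N *v x" "?N *v y"] by (simp add: PN)
  moreover have "0 < quadform ?N x" if "x \<noteq> 0" for x
  proof -
    have "?N *v x \<noteq> 0" using PN[of x] that by auto
    then have "0 < quadform P (?N *v x)" using assms by (auto simp: pd_def)
    then show ?thesis by (simp add: quadform_inner PN inner_commute)
  qed
  ultimately show "pd ?N"
    by (auto simp: pd_def hermitian_iff_self_adjoint)
qed

lemma pd_coercive:
  assumes "pd P"
  obtains \<delta> where "\<delta> > 0" "\<And>x. \<delta> * (norm x)\<^sup>2 \<le> quadform P x"
proof -
  have "compact (sphere (0::complex^'n) 1)" "sphere (0::complex^'n) 1 \<noteq> {}"
    by auto
  moreover have "continuous_on (sphere 0 1) (quadform P)"
    by (intro continuous_intros)
  ultimately obtain x0 where x0: "norm x0 = 1" "\<And>x. norm x = 1 \<Longrightarrow> quadform P x0 \<le> quadform P x"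
    using continuous_attains_inf[of "sphere 0 1" "quadform P"] by auto
  show thesis
  proof
    show "0 < quadform P x0" using assms x0(1) unfolding pd_def by (metis norm_zero zero_neq_one)
    show "quadform P x0 * (norm x)\<^sup>2 \<le> quadform P x" for x
    proof (cases "x = 0")
      case False
      then have "quadform P x0 \<le> quadform P (x /\<^sub>R norm x)" by (intro x0(2)) simp
      then show ?thesis using quadform_sphere[OF False, of P]
        by (metis mult.commute mult_left_mono zero_le_power2)
    qed (simp add: quadform_inner)
  qed
qed

lemma quadform_bounded:
  obtains s where "s > 0" "\<And>x. quadform (P::complex^'n^'n) x \<le> s * (norm x)\<^sup>2"
proof -
  have "bounded_linear (\<lambda>x. P *v x)" by (simp add: linear_linear)
  then obtain s where s: "s > 0" "\<And>x. norm (P *v x) \<le> norm x * s"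
    using bounded_linear.pos_bounded by blast
  have "quadform P x \<le> s * (norm x)\<^sup>2" for x
  proof -
    have "quadform P x \<le> norm x * norm (P *v x)" by (simp add: quadform_inner norm_cauchy_schwarz)
    also have "\<dots> \<le> norm x * (norm x * s)" by (intro mult_left_mono s) simp
    finally show ?thesis by (simp add: power2_eq_square mult_ac)
  qed
  with s(1) show thesis using that by blast
qed

section \<open>Powers of a matrix with spectral radius below one\<close>

text \<open>The vector \<open>p(M) v\<close>, computed by Horner's scheme. Acting on vectors rather than forming the matrix
\<open>p(M)\<close> lets linear factors of \<open>p\<close> be peeled off one at a time.\<close>

definition poly_act :: "complex^'n^'n \<Rightarrow> complex poly \<Rightarrow> complex^'n \<Rightarrow> complex^'n" where
  "poly_act M p v = fold_coeffs (\<lambda>a w. a *s v + M *v w) p 0"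

lemma poly_act_0 [simp]: "poly_act M 0 v = 0"
  by (simp add: poly_act_def)

lemma poly_act_pCons [simp]: "poly_act M (pCons a p) v = a *s v + M *v poly_act M p v"
  by (cases "p = 0 \<and> a = 0") (auto simp: poly_act_def)

lemma poly_act_add: "poly_act M (p + q) v = poly_act M p v + poly_act M q v"
proof (induction p arbitrary: q)
  case (pCons a p)
  obtain b r where "q = pCons b r" by (cases q)
  then show ?case using pCons
    by (simp add: matrix_vector_right_distrib vector_sadd_rdistrib)
qed simp

lemma poly_act_smult: "poly_act M (smult c p) v = c *s poly_act M p v"
  by (induction p) (simp_all add: vector_scalar_commute vector_add_ldistrib vector_smult_assoc)

lemma poly_act_shift: "poly_act M p (M *v v) = M *v poly_act M p v"
  by (induction p) (simp_all add: vector_scalar_commute matrix_vector_right_distrib)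

lemma poly_act_diff_vec: "poly_act M p (v - w) = poly_act M p v - poly_act M p w"
  by (induction p) (simp_all add: vector_ssub_ldistrib matrix_vector_mult_diff_distrib)

lemma poly_act_scale_vec: "poly_act M p (c *s v) = c *s poly_act M p v"
  by (induction p)
     (simp_all add: vector_scalar_commute vector_add_ldistrib vector_smult_assoc mult.commute)

lemma poly_act_linear_factor:
  "poly_act M ([:- l, 1:] * p) v = poly_act M p (M *v v - l *s v)"
proof -
  have "[:- l, 1:] * p = smult (- l) p + pCons 0 p" by simp
  then show ?thesis
    by (simp only: poly_act_add poly_act_smult poly_act_diff_vec poly_act_scale_vec poly_act_shift
        poly_act_pCons) (simp add: vec_eq_iff)
qed

lemma poly_act_eigenvector:
  assumes "M *v v = l *s v"
  shows "poly_act M p v = poly p l *s v"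
  by (induction p)
     (simp_all add: vector_scalar_commute assms vector_smult_assoc vector_sadd_rdistrib mult.commute)

lemma poly_act_monom: "poly_act M (monom c i) v = c *s (matpow M i *v v)"
proof (induction i)
  case 0
  then show ?case by (simp add: monom_0)
next
  case (Suc i)
  then show ?case by (simp add: monom_Suc vector_scalar_commute matrix_vector_mul_assoc)
qed

lemma poly_act_sum: "poly_act M (sum f S) v = (\<Sum>i\<in>S. poly_act M (f i) v)"
  by (induction S rule: infinite_finite_induct) (simp_all add: poly_act_add)

text \<open>The powers of \<open>M\<close> live in a space of finite real dimension, so finitely many of them are linearly
dependent already over the reals. If two powers coincide, their set is too small for this argument,
but their difference is an annihilating polynomial directly.\<close>

lemma annihilating_polynomial:
  fixes M :: "complex^'n^'n"
  obtains p where "p \<noteq> 0" "\<And>v. poly_act M p v = 0"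
proof (cases "inj_on (matpow M) {..DIM(complex^'n^'n)}")
  case False
  then obtain i j where ij: "i \<noteq> j" "matpow M i = matpow M j"
    by (auto simp: inj_on_def)
  show thesis
  proof
    show "monom 1 i + monom (-1) j \<noteq> (0 :: complex poly)"
    proof
      assume "monom 1 i + monom (-1) j = (0 :: complex poly)"
      then have "coeff (monom 1 i + monom (-1) j) i = (0::complex)" by simp
      then show False using ij(1) by simp
    qed
    show "poly_act M (monom 1 i + monom (-1) j) v = 0" for v
      by (simp add: poly_act_add poly_act_monom ij(2))
  qed
next
  case True
  define N where "N = DIM(complex^'n^'n)"
  have inj: "inj_on (matpow M) {..N}" using True by (simp add: N_def)
  let ?S = "matpow M ` {..N}"
  have "card ?S = Suc N" using inj by (simp add: card_image)
  then have "dependent ?S"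
    by (intro dependent_biggerset) (simp add: N_def)
  then obtain u where u: "\<exists>v\<in>?S. u v \<noteq> 0" "(\<Sum>v\<in>?S. u v *\<^sub>R v) = 0"
    by (subst (asm) dependent_finite) auto
  define c where "c i = complex_of_real (u (matpow M i))" for i
  obtain k where k: "k \<le> N" "c k \<noteq> 0" using u(1) by (auto simp: c_def)
  let ?p = "\<Sum>i\<le>N. monom (c i) i"
  have "(\<Sum>i\<le>N. u (matpow M i) *\<^sub>R matpow M i) = 0"
    using u(2) inj by (simp add: sum.reindex)
  then have sum0: "(\<Sum>i\<le>N. u (matpow M i) *\<^sub>R matpow M i) *v v = 0" for v
    by simp
  have "(\<Sum>i\<in>T. u (matpow M i) *\<^sub>R matpow M i) *v v = (\<Sum>i\<in>T. c i *s (matpow M i *v v))"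
    if "finite T" for T v
    using that
    by induction (simp_all add: matrix_vector_mult_add_rdistrib matrix_scaleR_vector
        scaleR_eq_scalar_mult c_def)
  then have act: "poly_act M ?p v = 0" for v
    using sum0[of v] by (simp add: poly_act_sum poly_act_monom)
  have "coeff ?p k = c k"
    using k(1) by (simp add: coeff_sum)
  then have "?p \<noteq> 0" using k(2) by (metis coeff_0)
  show thesis by (rule that[OF \<open>?p \<noteq> 0\<close> act])
qed

text \<open>Every eigenvalue is a root of an annihilating polynomial. Finiteness is what makes the maxima in
\<open>spec_radius\<close> and \<open>lambda_max\<close> meaningful.\<close>

lemma finite_eigvals: "finite (eigvals (M::complex^'n^'n))"
proof -
  obtain p where p: "p \<noteq> 0" "\<And>v. poly_act M p v = 0"
    using annihilating_polynomial[of M] by blast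
  have "eigvals M \<subseteq> {z. poly p z = 0}"
  proof
    fix l assume "l \<in> eigvals M"
    then obtain v where v: "v \<noteq> 0" "M *v v = l *s v" by (auto simp: eigvals_def)
    then have "poly p l *s v = 0" using poly_act_eigenvector[OF v(2), of p] p(2) by simp
    then show "l \<in> {z. poly p z = 0}" using v(1) by simp
  qed
  then show ?thesis using poly_roots_finite[OF p(1)] finite_subset by blast
qed

text \<open>Applying the linear factors of \<open>p\<close> to \<open>v\<close> one after the other leads from outside \<open>W\<close> into \<open>W\<close>, so
one of the factors makes the step. When \<open>W\<close> is an invariant subspace,
the conclusion says that \<open>l\<close> is an eigenvalue of \<open>M\<close> on the quotient by \<open>W\<close>.\<close>

lemma exists_root_outside_subspace:
  assumes "p \<noteq> 0" "poly_act M p v \<in> W" "v \<notin> W"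
    and scale: "\<And>c w. w \<in> W \<Longrightarrow> c *s w \<in> W"
  shows "\<exists>l w. w \<notin> W \<and> M *v w - l *s w \<in> W"
  using assms(1-3)
proof (induction "degree p" arbitrary: p v)
  case 0
  then obtain c where c: "p = [:c:]" "c \<noteq> 0" by (metis degree_eq_zeroE pCons_eq_0_iff)
  then have "inverse c *s (c *s v) \<in> W" using 0 scale by (metis add.right_neutral matrix_vector_mult_0_right poly_act_0 poly_act_pCons)
  then have "v \<in> W" using c(2) by (simp add: vector_smult_assoc)
  then show ?case using 0 by blast
next
  case (Suc n)
  have "\<not> constant (poly p)" using Suc.hyps(2) by (simp add: constant_degree)
  then obtain l where "poly p l = 0" using fundamental_theorem_of_algebra by blast
  then obtain r where r: "p = [:- l, 1:] * r" by (metis dvdE poly_eq_0_iff_dvd)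
  have r0: "r \<noteq> 0" using Suc.prems(1) r by auto
  then have "degree p = Suc (degree r)" unfolding r by (subst degree_mult_eq) auto
  then have deg: "n = degree r" using Suc.hyps(2) by simp
  show ?case
  proof (cases "M *v v - l *s v \<in> W")
    case False
    have "poly_act M r (M *v v - l *s v) \<in> W"
      using Suc.prems(2) unfolding r poly_act_linear_factor .
    with Suc.hyps(1)[OF deg r0] False show ?thesis by blast
  qed (use Suc.prems in blast)
qed

text \<open>Summing the norms in the recursion gives \<open>S \<le> \<parallel>x\<^sub>0\<parallel> + \<bar>l\<bar> S + E\<close> for the partial sums \<open>S\<close>, with \<open>E\<close>
the total norm of the perturbation; as \<open>\<bar>l\<bar> < 1\<close>, the partial sums are bounded.\<close>

lemma summable_perturbed_geometric:
  fixes x :: "nat \<Rightarrow> complex^'n"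
  assumes rec: "\<And>k. x (Suc k) = l *s x k + e k" and l: "cmod l < 1"
    and e: "summable (\<lambda>k. norm (e k))"
  shows "summable (\<lambda>k. norm (x k))"
proof (rule bounded_imp_summable)
  fix n
  let ?s = "\<lambda>n. \<Sum>k\<le>n. norm (x k)"
  let ?E = "\<Sum>k. norm (e k)"
  have "?s (Suc n) = norm (x 0) + (\<Sum>k\<le>n. norm (x (Suc k)))"
    by (rule sum.atMost_Suc_shift)
  also have "\<dots> \<le> norm (x 0) + (\<Sum>k\<le>n. cmod l * norm (x k) + norm (e k))"
    unfolding rec by (intro add_left_mono sum_mono) (metis norm_scalar_mult norm_triangle_ineq)
  also have "\<dots> = norm (x 0) + cmod l * ?s n + (\<Sum>k\<le>n. norm (e k))"
    by (simp add: sum.distrib sum_distrib_left)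
  also have "\<dots> \<le> norm (x 0) + cmod l * ?s n + ?E"
    by (intro add_left_mono sum_le_suminf e) auto
  finally have "?s (Suc n) \<le> norm (x 0) + cmod l * ?s n + ?E" .
  moreover have "?s n \<le> ?s (Suc n)" by simp
  ultimately have "?s n \<le> norm (x 0) + cmod l * ?s n + ?E" by linarith
  then have "(1 - cmod l) * ?s n \<le> norm (x 0) + ?E" by (simp add: algebra_simps)
  then show "?s n \<le> (norm (x 0) + ?E) / (1 - cmod l)" using l by (simp add: field_simps)
qed simp

lemma inj_on_subspace_onto:
  fixes f :: "'a::euclidean_space \<Rightarrow> 'a"
  assumes "linear f" "inj f" "subspace W" "f ` W \<subseteq> W" "w \<in> W"
  shows "\<exists>w'\<in>W. f w' = w"
proof -
  have "dim (f ` W) = dim W"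
    using assms by (intro dim_image_eq) (auto intro: inj_on_subset)
  then have "f ` W = W"
    using assms by (intro subspace_dim_equal) (auto intro: linear_subspace_image)
  then show ?thesis using assms(5) by (metis imageE)
qed

text \<open>Let \<open>W\<close> be the subspace of vectors with a summable orbit. If \<open>W\<close> were proper, some \<open>w\<close> outside \<open>W\<close>
would satisfy \<open>(M - l) w \<in> W\<close>. When \<open>l\<close> is an eigenvalue, \<open>\<bar>l\<bar> < 1\<close> and the orbit of \<open>w\<close> is a summably
perturbed geometric sequence, so \<open>w \<in> W\<close>. When \<open>l\<close> is not an eigenvalue, \<open>M - l\<close> is injective and maps
the finite-dimensional \<open>W\<close> onto itself, so again \<open>w \<in> W\<close>.\<close>

lemma summable_matpow_orbit:
  fixes M :: "complex^'n^'n"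
  assumes "\<And>l. l \<in> eigvals M \<Longrightarrow> cmod l < 1"
  shows "summable (\<lambda>k. norm (matpow M k *v v))"
proof -
  define W where "W = {v. summable (\<lambda>k. norm (matpow M k *v v))}"
  have scale: "c *s w \<in> W" if "w \<in> W" for c w
    using that by (simp add: W_def vector_scalar_commute norm_scalar_mult summable_mult)
  have add: "v + w \<in> W" if "v \<in> W" "w \<in> W" for v w
  proof -
    have "summable (\<lambda>k. norm (matpow M k *v v) + norm (matpow M k *v w))"
      using that by (auto simp: W_def intro: summable_add)
    then have "summable (\<lambda>k. norm (matpow M k *v (v + w)))"
      by (rule summable_comparison_test'[where N=0])
         (simp add: matrix_vector_right_distrib norm_triangle_ineq)
    then show ?thesis by (simp add: W_def)
  qed
  have sub: "subspace W"
    unfolding subspace_def using scale add by (auto simp: scaleR_eq_scalar_mult W_def)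
  have shift: "matpow M k *v (M *v w) = matpow M (Suc k) *v w" for k w
    by (simp add: matrix_vector_mul_assoc matpow_commute)
  have inv: "M *v w \<in> W" if "w \<in> W" for w
    using that summable_Suc_iff[of "\<lambda>k. norm (matpow M k *v w)"] by (simp only: W_def mem_Collect_eq shift)
  obtain p where p: "p \<noteq> 0" "\<And>v. poly_act M p v = 0"
    using annihilating_polynomial[of M] by blast
  have "v \<in> W"
  proof (rule ccontr)
    assume "v \<notin> W"
    then obtain l w where w: "w \<notin> W" "M *v w - l *s w \<in> W"
      using exists_root_outside_subspace[of p M v W] p scale subspace_0[OF sub] by auto
    let ?f = "\<lambda>y. M *v y - l *s y"
    show False
    proof (cases "l \<in> eigvals M")
      case True
      then have l: "cmod l < 1" by (rule assms)
      have rec: "matpow M (Suc k) *v w = l *s (matpow M k *v w) + matpow M k *v ?f w" for k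
        by (simp add: shift[symmetric] matrix_vector_mult_diff_distrib vector_scalar_commute del: matpow.simps)
      have "summable (\<lambda>k. norm (matpow M k *v ?f w))"
        using w(2) by (simp add: W_def)
      from summable_perturbed_geometric[where x="\<lambda>k. matpow M k *v w", OF rec l this]
      have "summable (\<lambda>k. norm (matpow M k *v w))" .
      then show False using w(1) by (simp add: W_def)
    next
      case False
      then have ker: "y = 0" if "?f y = 0" for y
        using that by (auto simp: eigvals_def)
      have lin: "linear ?f"
        by (rule linearI) (simp_all add: matrix_vector_right_distrib vector_add_ldistrib
          scaleR_eq_scalar_mult vector_scalar_commute vector_smult_assoc vector_ssub_ldistrib mult.commute)
      have inj: "inj ?f" using ker lin by (simp add: linear_injective_0)
      have "?f ` W \<subseteq> W"
      proof
        fix y assume "y \<in> ?f ` W"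
        then obtain z where "z \<in> W" "y = ?f z" by blast
        then show "y \<in> W" using subspace_diff[OF sub inv scale] by simp
      qed
      from inj_on_subspace_onto[OF lin inj sub this w(2)]
      obtain w' where w': "w' \<in> W" "?f w' = ?f w" by blast
      have "w' = w" by (rule injD[OF inj w'(2)])
      then show False using w(1) w'(1) by simp
    qed
  qed
  then show ?thesis by (simp add: W_def)
qed

lemma matpow_orbit_tendsto_0:
  assumes "spec_radius A < 1"
  shows "(\<lambda>k. matpow (cmat A) k *v v) \<longlonglongrightarrow> 0"
proof -
  have "cmod l < 1" if "l \<in> eigvals (cmat A)" for l
  proof -
    have "cmod l \<le> spec_radius A"
      unfolding spec_radius_def using that finite_eigvals by (intro Max_ge) auto
    with assms show ?thesis by simp
  qed
  from summable_LIMSEQ_zero[OF summable_matpow_orbit[OF this]]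
  show ?thesis by (simp add: tendsto_norm_zero_iff)
qed

text \<open>Used in the contrapositive: a positive spectral radius rules out the zero matrix, for which
\<open>matnorm_P\<close> would be 0 and its logarithm meaningless.\<close>

lemma spec_radius_zero_matrix: "spec_radius (0::real^'n^'n) = 0"
proof -
  have "cmat (0::real^'n^'n) = 0" by (simp add: vec_eq_iff)
  moreover have "eigvals (0::complex^'n^'n) = {0}"
    using zero_neq_one by (auto simp: eigvals_def intro!: exI[of _ "axis undefined 1"])
  ultimately show ?thesis by (simp add: spec_radius_def)
qed

section \<open>Largest eigenvalues\<close>

lemma bdd_above_compact_image:
  fixes f :: "'a::topological_space \<Rightarrow> real"
  assumes "compact K" "continuous_on K f"
  shows "bdd_above (f ` K)"
  by (intro bounded_imp_bdd_above compact_imp_bounded compact_continuous_image assms)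

text \<open>Let \<open>m\<close> be the maximum of the quadratic form on the unit sphere, attained at \<open>x\<close>. The matrix \<open>m I - M\<close>
is positive semidefinite and its form vanishes at \<open>x\<close>, so \<open>x\<close> is in its kernel and \<open>m\<close> is an eigenvalue.
Conversely, the real part of any eigenvalue is a value of the form on the sphere.\<close>

lemma lambda_max_attained:
  fixes M :: "complex^'n^'n"
  assumes h: "hermitian M"
  obtains x where "norm x = 1" "M *v x = lambda_max M *\<^sub>R x"
    "lambda_max M = quadform M x" "\<And>y. quadform M y \<le> lambda_max M * (norm y)\<^sup>2"
proof -
  have "compact (sphere (0::complex^'n) 1)" "sphere (0::complex^'n) 1 \<noteq> {}"
    by auto
  moreover have "continuous_on (sphere 0 1) (quadform M)"
    by (intro continuous_intros)
  ultimately obtain x0 where x0: "norm x0 = 1" "\<And>x. norm x = 1 \<Longrightarrow> quadform M x \<le> quadform M x0"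
    using continuous_attains_sup[of "sphere 0 1" "quadform M"] by auto
  define m where "m = quadform M x0"
  have le: "quadform M y \<le> m * (norm y)\<^sup>2" for y
  proof (cases "y = 0")
    case False
    then have "quadform M (y /\<^sub>R norm y) \<le> m" unfolding m_def by (intro x0(2)) simp
    then show ?thesis using quadform_sphere[OF False, of M]
      by (metis mult.commute mult_left_mono zero_le_power2)
  qed (simp add: quadform_inner)
  have "psd (m *\<^sub>R mat 1 - M)"
    using le by (simp add: psd_def quadform_diff quadform_scaleR quadform_mat_1
        hermitian_diff hermitian_scaleR hermitian_mat_1 h)
  moreover have "quadform (m *\<^sub>R mat 1 - M) x0 = 0"
    by (simp add: quadform_diff quadform_scaleR quadform_mat_1 x0(1) m_def)
  ultimately have "(m *\<^sub>R mat 1 - M) *v x0 = 0" by (rule psd_null_vector)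
  then have eigen: "M *v x0 = m *\<^sub>R x0"
    by (simp add: matrix_vector_mult_diff_rdistrib matrix_scaleR_vector)
  then have "M *v x0 = complex_of_real m *s x0"
    by (simp only: scaleR_eq_scalar_mult)
  then have mem: "complex_of_real m \<in> eigvals M"
    using x0(1) by (auto simp: eigvals_def intro!: exI[of _ x0])
  have "Re l \<le> m" if l: "l \<in> eigvals M" for l
  proof -
    obtain v where v: "v \<noteq> 0" "M *v v = l *s v" using l by (auto simp: eigvals_def)
    have "Re l * (norm v)\<^sup>2 \<le> m * (norm v)\<^sup>2"
      using le[of v] by (simp add: quadform_inner v(2) inner_scalar_mult_self)
    then show ?thesis using v(1) by simp
  qed
  then have "lambda_max M = m"
    unfolding lambda_max_def using mem finite_eigvals[of M]
    by (intro Max_eqI) (auto intro: rev_image_eqI)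
  then show thesis using that[of x0] x0(1) le eigen by (simp add: m_def)
qed

lemma lambda_max_pos: "pd M \<Longrightarrow> 0 < lambda_max M"
  by (metis lambda_max_attained norm_zero pd_def zero_neq_one)

lemma hermitian_zero_quadform:
  assumes "hermitian M" "\<And>x. quadform M x = 0"
  shows "M = 0"
  unfolding matrix_eq using assms psd_null_vector[of M] by (simp add: psd_def)

section \<open>The positive definite square root\<close>

text \<open>The largest eigenvalue of \<open>S - T\<close> must be 0: multiplied by the positive number
\<open>quadform S v + quadform T v\<close>, where \<open>v\<close> is an eigenvector, it equals the form of \<open>S\<^sup>2 - T\<^sup>2 = 0\<close>
at \<open>v\<close>.\<close>

lemma sqrt_difference_nonpos:
  fixes S T :: "complex^'n^'n"
  assumes S: "pd S" and T: "pd T" and eq: "S ** S = T ** T"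
  shows "quadform (S - T) x \<le> 0"
proof -
  have hS: "hermitian S" and hT: "hermitian T" using S T by (simp_all add: pd_def)
  let ?l = "lambda_max (S - T)"
  obtain v where v: "norm v = 1" "(S - T) *v v = ?l *\<^sub>R v"
    "\<And>y. quadform (S - T) y \<le> ?l * (norm y)\<^sup>2"
    using lambda_max_attained[OF hermitian_diff[OF hS hT]] by metis
  then have D: "S *v v - T *v v = ?l *\<^sub>R v"
    by (simp add: matrix_vector_mult_diff_rdistrib)
  \<comment> \<open>Test \<open>0 = S\<^sup>2 - T\<^sup>2 = S (S - T) + (S - T) T\<close> on the eigenvector \<open>v\<close>.\<close>
  have "S *v (S *v v) = T *v (T *v v)" by (simp add: matrix_vector_mul_assoc eq)
  then have "0 = v \<bullet> (S *v (S *v v - T *v v)) + v \<bullet> (S *v (T *v v)) - v \<bullet> (T *v (T *v v))"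
    by (simp add: matrix_vector_mult_diff_distrib inner_diff_right)
  also have "\<dots> = ?l * quadform S v + (S *v v - T *v v) \<bullet> (T *v v)"
    using hermitianD[OF hS, of v "T *v v"] hermitianD[OF hT, of v "T *v v"]
    unfolding inner_diff_left by (simp add: D matrix_vector_scaleR quadform_inner)
  also have "\<dots> = ?l * (quadform S v + quadform T v)"
    by (simp add: D quadform_inner algebra_simps)
  finally have "?l * (quadform S v + quadform T v) = 0" by simp
  moreover have "v \<noteq> 0" using v(1) by auto
  then have "quadform S v + quadform T v > 0"
    using S T by (simp add: pd_def add_pos_pos)
  ultimately have "?l = 0" by auto
  then show ?thesis using v(3)[of x] by simp
qed

lemma pd_sqrt_unique:
  fixes S T :: "complex^'n^'n"
  assumes S: "pd S" and T: "pd T" and eq: "S ** S = T ** T"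
  shows "S = T"
proof -
  have "hermitian (S - T)" using S T by (simp add: hermitian_diff pd_def)
  moreover have "quadform (S - T) x = 0" for x
    using sqrt_difference_nonpos[OF S T eq, of x] sqrt_difference_nonpos[OF T S eq[symmetric], of x]
    by (simp add: quadform_diff)
  ultimately have "S - T = 0" by (rule hermitian_zero_quadform)
  then show ?thesis by simp
qed

text \<open>Real-linear maps that commute with complex scalars are complex linear; this carries the operator
found by the fixed point theorem back to a matrix.\<close>

lemma real_linear_matrix:
  fixes f :: "complex^'n \<Rightarrow> complex^'n"
  assumes "linear f" "\<And>z x. f (z *s x) = z *s f x"
  shows "matrix f *v x = f x"
proof (rule matrix_works)
  show "Vector_Spaces.linear (*s) (*s) f"
    using assms linear_add by unfold_locales auto
qed

text \<open>If \<open>Y\<close> satisfies \<open>2 Y = B + Y\<^sup>2\<close>, then \<open>(I - Y)\<^sup>2 = I - B\<close>. The map \<open>Y \<mapsto> (B + Y\<^sup>2) / 2\<close> preserves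
the operators of norm at most \<open>c\<close> and contracts distances by the factor \<open>c\<close>, because
\<open>Y\<^sup>2 - Z\<^sup>2 = Y (Y - Z) + (Y - Z) Z\<close>; Banach's fixed point theorem applies. Bounded operators take the
place of matrices because the hypothesis on \<open>B\<close> controls the operator norm, which is not the norm of
the matrix type.\<close>

lemma square_root_fixed_point:
  fixes B :: "complex^'n^'n"
  assumes h: "hermitian B" and c: "0 \<le> c" "c < 1" and B: "\<And>x. norm (B *v x) \<le> c * norm x"
  obtains Y where "hermitian Y" "\<And>x. norm (Y *v x) \<le> c * norm x" "2 *\<^sub>R Y = B + Y ** Y"
proof -
  define b where "b = Blinfun (\<lambda>x. B *v x)"
  have b: "blinfun_apply b x = B *v x" for x
    unfolding b_def by (simp add: bounded_linear_Blinfun_apply linear_linear)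
  define E where "E = {f :: (complex^'n) \<Rightarrow>\<^sub>L (complex^'n). norm f \<le> c \<and>
    (\<forall>x y. x \<bullet> blinfun_apply f y = blinfun_apply f x \<bullet> y) \<and> (\<forall>z x. blinfun_apply f (z *s x) = z *s blinfun_apply f x)}"
  define \<phi> where "\<phi> f = (1/2) *\<^sub>R (b + (f o\<^sub>L f))" for f
  have "norm b \<le> c"
    using B c by (intro norm_blinfun_bound) (simp_all add: b)
  have cont: "continuous_on UNIV (\<lambda>f. blinfun_apply f x :: complex^'n)" for x :: "complex^'n"
    by (intro continuous_intros)
  have "closed {f :: (complex^'n) \<Rightarrow>\<^sub>L (complex^'n). x \<bullet> blinfun_apply f y = blinfun_apply f x \<bullet> y}" for x y
    by (intro closed_Collect_eq continuous_intros cont)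
  moreover have "closed {f :: (complex^'n) \<Rightarrow>\<^sub>L (complex^'n). blinfun_apply f (z *s x) = z *s blinfun_apply f x}" for z x
  proof -
    have "bounded_linear (\<lambda>y::complex^'n. z *s y)"
      by (intro linear_conv_bounded_linear[THEN iffD1] linearI)
         (simp_all add: vector_add_ldistrib scaleR_eq_scalar_mult vector_smult_assoc mult.commute)
    then have "continuous_on UNIV (\<lambda>f. z *s (blinfun_apply f x :: complex^'n))"
      by (rule bounded_linear.continuous_on[OF _ cont[of x]])
    then show ?thesis by (intro closed_Collect_eq cont)
  qed
  moreover have "closed {f :: (complex^'n) \<Rightarrow>\<^sub>L (complex^'n). norm f \<le> c}"
    by (intro closed_Collect_le continuous_intros)
  ultimately have "closed E"
    unfolding E_def by (intro closed_Collect_conj closed_Collect_all)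
  then have comp: "complete E" by (simp add: complete_eq_closed)
  have "0 \<in> E" using c by (simp add: E_def)
  then have ne: "E \<noteq> {}" by blast
  have maps: "\<phi> ` E \<subseteq> E"
  proof
    fix g assume "g \<in> \<phi> ` E"
    then obtain f where f: "f \<in> E" and g: "g = \<phi> f" by blast
    have app: "blinfun_apply (\<phi> f) x = (1/2) *\<^sub>R (B *v x + blinfun_apply f (blinfun_apply f x))" for x
      by (simp add: \<phi>_def b blinfun.bilinear_simps)
    have "norm (f o\<^sub>L f) \<le> c"
    proof -
      have "norm (f o\<^sub>L f) \<le> norm f * norm f" by (rule norm_blinfun_compose)
      also have "\<dots> \<le> c * 1" using f c by (intro mult_mono) (auto simp: E_def)
      finally show ?thesis by simp
    qed
    then have "norm (\<phi> f) \<le> c"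
      using norm_triangle_ineq[of b "f o\<^sub>L f"] \<open>norm b \<le> c\<close> by (simp add: \<phi>_def)
    moreover have "x \<bullet> blinfun_apply (\<phi> f) y = blinfun_apply (\<phi> f) x \<bullet> y" for x y
    proof -
      have "x \<bullet> blinfun_apply f (blinfun_apply f y) = blinfun_apply f (blinfun_apply f x) \<bullet> y"
        using f by (simp add: E_def)
      then show ?thesis unfolding app
        using hermitianD[OF h, of x y] by (simp add: inner_add_left inner_add_right)
    qed
    moreover have "blinfun_apply (\<phi> f) (z *s x) = z *s blinfun_apply (\<phi> f) x" for z x
    proof -
      have "blinfun_apply f (blinfun_apply f (z *s x)) = z *s blinfun_apply f (blinfun_apply f x)"
        using f by (simp add: E_def)
      then show ?thesis unfolding app
        by (simp add: vector_scalar_commute scaleR_eq_scalar_mult vector_add_ldistrib vector_smult_assoc mult.commute)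
    qed
    ultimately show "g \<in> E" by (simp add: E_def g)
  qed
  have lip: "dist (\<phi> f) (\<phi> g) \<le> c * dist f g" if "f \<in> E" "g \<in> E" for f g
  proof -
    have "\<phi> f - \<phi> g = (1/2) *\<^sub>R ((f o\<^sub>L (f - g)) + ((f - g) o\<^sub>L g))"
      by (rule blinfun_eqI) (simp add: \<phi>_def blinfun.bilinear_simps flip: scaleR_diff_right)
    then have "dist (\<phi> f) (\<phi> g) = norm ((f o\<^sub>L (f - g)) + ((f - g) o\<^sub>L g)) / 2"
      by (simp add: dist_norm)
    also have "\<dots> \<le> (norm f * norm (f - g) + norm (f - g) * norm g) / 2"
      by (intro divide_right_mono norm_triangle_le add_mono norm_blinfun_compose) simp
    also have "\<dots> \<le> (c * norm (f - g) + norm (f - g) * c) / 2"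
      using that by (intro divide_right_mono add_mono mult_right_mono mult_left_mono) (auto simp: E_def)
    finally show ?thesis by (simp add: dist_norm)
  qed
  obtain f where f: "f \<in> E" "\<phi> f = f"
    using Banach_fix[OF comp ne c maps lip] by blast
  define Y where "Y = matrix (blinfun_apply f)"
  have Y: "Y *v x = blinfun_apply f x" for x
    unfolding Y_def using f(1)
    by (intro real_linear_matrix) (auto simp: E_def intro: bounded_linear.linear blinfun.bounded_linear_right)
  show thesis
  proof
    show "hermitian Y" using f(1) by (simp add: hermitian_iff_self_adjoint Y E_def)
    show "norm (Y *v x) \<le> c * norm x" for x
    proof -
      have "norm (Y *v x) \<le> norm f * norm x" unfolding Y by (rule norm_blinfun)
      also have "\<dots> \<le> c * norm x" using f(1) by (intro mult_right_mono) (auto simp: E_def)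
      finally show ?thesis .
    qed
    have "(2 *\<^sub>R Y) *v x = (B + Y ** Y) *v x" for x
    proof -
      have "2 *\<^sub>R blinfun_apply f x = 2 *\<^sub>R blinfun_apply (\<phi> f) x" by (simp add: f(2))
      also have "\<dots> = B *v x + blinfun_apply f (blinfun_apply f x)"
        by (simp add: \<phi>_def b blinfun.bilinear_simps)
      finally show ?thesis
        by (simp add: matrix_scaleR_vector matrix_vector_mult_add_rdistrib Y
            matrix_vector_mul_assoc[symmetric])
    qed
    then show "2 *\<^sub>R Y = B + Y ** Y" by (simp add: matrix_eq)
  qed
qed

text \<open>After division by an upper bound \<open>s\<close> of its form, \<open>N\<close> becomes \<open>I - B\<close> with \<open>0 \<le> B \<le> c I\<close> and
\<open>c < 1\<close>; the fixed point \<open>Y\<close> then yields the root \<open>\<surd>s (I - Y)\<close>.\<close>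

lemma pd_sqrt_exists:
  fixes N :: "complex^'n^'n"
  assumes "pd N"
  obtains S where "pd S" "S ** S = N"
proof -
  obtain \<delta> where \<delta>: "\<delta> > 0" "\<And>x. \<delta> * (norm x)\<^sup>2 \<le> quadform N x" using pd_coercive[OF assms] by blast
  obtain s where s: "s > 0" "\<And>x. quadform N x \<le> s * (norm x)\<^sup>2" using quadform_bounded[of N] by blast
  have hN: "hermitian N" using assms by (simp add: pd_def)
  define B where "B = mat 1 - (1/s) *\<^sub>R N"
  define c where "c = 1 - \<delta> / s"
  have "\<delta> \<le> s"
  proof -
    obtain x :: "complex^'n" where "norm x = 1" using vector_choose_size[of 1] by auto
    then show ?thesis using \<delta>(2)[of x] s(2)[of x] by simp
  qed
  then have c: "0 \<le> c" "c < 1" using s(1) \<delta>(1) by (auto simp: c_def)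
  have hB: "hermitian B" unfolding B_def by (intro hermitian_diff hermitian_scaleR hermitian_mat_1 hN)
  have qB: "quadform B x = (norm x)\<^sup>2 - quadform N x / s" for x
    by (simp add: B_def quadform_diff quadform_scaleR quadform_mat_1)
  have "psd B" using s hB by (auto simp: psd_def qB field_simps)
  moreover have "quadform B x \<le> c * (norm x)\<^sup>2" for x
    using \<delta>(2)[of x] s(1) by (simp add: qB c_def field_simps)
  ultimately have "norm (B *v x) \<le> c * norm x" for x by (rule psd_norm_bound)
  then obtain Y where Y: "hermitian Y" "\<And>x. norm (Y *v x) \<le> c * norm x" "2 *\<^sub>R Y = B + Y ** Y"
    using square_root_fixed_point[OF hB c] by blast
  define S where "S = sqrt s *\<^sub>R (mat 1 - Y)"
  have "quadform Y x < (norm x)\<^sup>2" if "x \<noteq> 0" for x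
  proof -
    have "quadform Y x \<le> norm x * norm (Y *v x)" by (simp add: quadform_inner norm_cauchy_schwarz)
    also have "\<dots> \<le> norm x * (c * norm x)" by (intro mult_left_mono Y) simp
    also have "\<dots> < norm x * norm x" using c that by simp
    finally show ?thesis by (simp add: power2_eq_square)
  qed
  then have "pd S" unfolding S_def using s(1)
    by (intro pd_scaleR) (auto simp: pd_def quadform_diff quadform_mat_1 intro: hermitian_diff hermitian_mat_1 Y)
  moreover have "S ** S = N"
    unfolding matrix_eq
  proof
    fix x
    have "2 *\<^sub>R (Y *v x) = x - (1/s) *\<^sub>R (N *v x) + Y *v (Y *v x)"
      using arg_cong[OF Y(3), of "\<lambda>M. M *v x"]
      by (simp add: B_def matrix_scaleR_vector matrix_vector_mult_add_rdistrib
          matrix_vector_mult_diff_rdistrib matrix_vector_mul_assoc)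
    then have *: "x - 2 *\<^sub>R (Y *v x) + Y *v (Y *v x) = (1/s) *\<^sub>R (N *v x)" by simp
    have "S ** S *v x = s *\<^sub>R (x - 2 *\<^sub>R (Y *v x) + Y *v (Y *v x))"
      using s(1)
      by (simp add: S_def matrix_vector_mul_assoc[symmetric] matrix_scaleR_vector matrix_vector_scaleR
          matrix_vector_mult_diff_rdistrib matrix_vector_mult_diff_distrib scaleR_2 scaleR_diff_right
          scaleR_add_right)
    then show "S ** S *v x = N *v x" using s(1) unfolding * by simp
  qed
  ultimately show thesis by (rule that)
qed

lemma inv_sqrt_properties:
  assumes "pd P"
  shows "pd (inv_sqrt P)" "inv_sqrt P ** inv_sqrt P = matrix_inv P"
proof -
  have "\<exists>!S. pd S \<and> S ** S = matrix_inv P"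
    using pd_sqrt_exists[OF pd_inverse(3)[OF assms]] pd_sqrt_unique by metis
  from theI'[OF this] show "pd (inv_sqrt P)" "inv_sqrt P ** inv_sqrt P = matrix_inv P"
    unfolding inv_sqrt_def by auto
qed

section \<open>The Stein equation\<close>

text \<open>The map \<open>R \<mapsto> R - C\<^sup>T R C\<close> is linear on a finite-dimensional space. It is injective, because a form
invariant under \<open>C\<close> is constant along orbits, which tend to 0; hence it is bijective. The same
principle, applied to the antisymmetric part of the form of \<open>R\<close>, shows that the solution \<open>R\<close> is
Hermitian. It is positive definite because \<open>quadform R x = \<parallel>x\<parallel>\<^sup>2 + quadform R (C x)\<close>, where the last
term starts a decreasing sequence with limit 0.\<close>

lemma stein_equation_unique_solution:
  fixes C :: "complex^'n^'n"
  assumes C: "C = cmat B" and orb: "\<And>v. (\<lambda>k. matpow C k *v v) \<longlonglongrightarrow> 0"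
  shows "\<exists>!R. pd R \<and> R - transpose C ** R ** C = mat 1"
proof -
  define \<Phi> where "\<Phi> R = R - transpose C ** R ** C" for R
  have form: "x \<bullet> (\<Phi> R *v y) = x \<bullet> (R *v y) - (C *v x) \<bullet> (R *v (C *v y))" for R x y
    unfolding \<Phi>_def matrix_vector_mult_diff_rdistrib inner_diff_right C
    by (simp only: cmat_adjoint matrix_vector_mul_assoc[symmetric])
  have shift: "C *v (matpow C k *v v) = matpow C (Suc k) *v v" for k v
    by (simp add: matrix_vector_mul_assoc)
  have tend: "(\<lambda>k. (matpow C k *v x) \<bullet> (M *v (matpow C k *v y))) \<longlonglongrightarrow> 0" for M x y
  proof -
    have "(\<lambda>k. M *v (matpow C k *v y)) \<longlonglongrightarrow> M *v 0"
      by (rule bounded_linear.tendsto[OF _ orb]) (simp add: linear_linear)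
    from tendsto_inner[OF orb[of x] this] show ?thesis by simp
  qed
  \<comment> \<open>A form invariant under \<open>C\<close> equals its limit along orbits, which is 0.\<close>
  have invariant_zero: "s x y = 0"
    if inv: "\<And>x y. s x y = s (C *v x) (C *v y)"
      and lim: "\<And>x y. (\<lambda>k. s (matpow C k *v x) (matpow C k *v y)) \<longlonglongrightarrow> (0::real)" for s x y
  proof -
    have "s (matpow C k *v x) (matpow C k *v y) = s x y" for k
    proof (induction k)
      case (Suc k)
      then show ?case using inv[of "matpow C k *v x" "matpow C k *v y"] unfolding shift by simp
    qed simp
    with lim[of x y] show ?thesis by (simp add: LIMSEQ_const_iff)
  qed
  have lin: "linear \<Phi>"
    by (rule linearI)
       (simp_all add: \<Phi>_def matrix_eq matrix_vector_mul_assoc[symmetric] matrix_scaleR_vector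
         matrix_vector_scaleR matrix_vector_mult_add_rdistrib matrix_vector_mult_diff_rdistrib
         matrix_vector_right_distrib scaleR_diff_right del: transpose_matrix_vector)
  have inj: "inj \<Phi>"
    unfolding linear_injective_0[OF lin]
  proof (intro allI impI)
    fix R assume "\<Phi> R = 0"
    then have "x \<bullet> (R *v y) = (C *v x) \<bullet> (R *v (C *v y))" for x y
      using form[of x R y] by simp
    from invariant_zero[where s="\<lambda>x y. x \<bullet> (R *v y)", OF this tend]
    have "x \<bullet> (R *v y) = 0" for x y .
    then have "R *v y = 0" for y by (metis inner_eq_zero_iff)
    then show "R = 0" by (simp add: matrix_eq)
  qed
  then obtain R where R: "\<Phi> R = mat 1"
    using linear_injective_imp_surjective[OF lin inj] by (metis surjD)
  have rec: "x \<bullet> (R *v y) = x \<bullet> y + (C *v x) \<bullet> (R *v (C *v y))" for x y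
    using form[of x R y] by (simp add: R)
  have "x \<bullet> (R *v y) - y \<bullet> (R *v x) = 0" for x y
  proof (rule invariant_zero[where s="\<lambda>x y. x \<bullet> (R *v y) - y \<bullet> (R *v x)"])
    show "x \<bullet> (R *v y) - y \<bullet> (R *v x)
        = (C *v x) \<bullet> (R *v (C *v y)) - (C *v y) \<bullet> (R *v (C *v x))" for x y
      using rec[of x y] rec[of y x] by (simp add: inner_commute)
    show "(\<lambda>k. (matpow C k *v x) \<bullet> (R *v (matpow C k *v y))
        - (matpow C k *v y) \<bullet> (R *v (matpow C k *v x))) \<longlonglongrightarrow> 0" for x y
      using tendsto_diff[OF tend tend] by simp
  qed
  then have "hermitian R"
    unfolding hermitian_iff_self_adjoint by (metis eq_iff_diff_eq_0 inner_commute)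
  moreover have "0 < quadform R x" if "x \<noteq> 0" for x
  proof -
    have "decseq (\<lambda>k. quadform R (matpow C k *v x))"
    proof (rule decseq_SucI)
      fix k
      let ?y = "matpow C k *v x"
      have "quadform R ?y = ?y \<bullet> ?y + quadform R (C *v ?y)"
        unfolding quadform_inner by (rule rec)
      then show "quadform R (matpow C (Suc k) *v x) \<le> quadform R ?y"
        unfolding shift by simp
    qed
    moreover have "(\<lambda>k. quadform R (matpow C k *v x)) \<longlonglongrightarrow> 0"
      using tend by (simp add: quadform_inner)
    ultimately have "0 \<le> quadform R (matpow C 1 *v x)" by (rule decseq_ge)
    then have "0 \<le> quadform R (C *v x)" by simp
    moreover have "quadform R x = x \<bullet> x + quadform R (C *v x)"
      unfolding quadform_inner by (rule rec)
    ultimately show ?thesis using that by (simp add: add_pos_nonneg)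
  qed
  ultimately have "pd R" by (simp add: pd_def)
  then show ?thesis
    using R inj unfolding \<Phi>_def[symmetric] by (metis injD)
qed

lemma lyap_nonempty:
  assumes "spec_radius A < 1"
  shows "lyap A \<noteq> {}"
proof -
  obtain R where R: "pd R" "R - transpose (cmat A) ** R ** cmat A = mat 1"
    using stein_equation_unique_solution[OF refl matpow_orbit_tendsto_0[OF assms]] by blast
  have "pd (mat 1 :: complex^'a^'a)" by (simp add: pd_def hermitian_mat_1 quadform_mat_1)
  then have "R \<in> lyap A" using R by (simp add: lyap_def pd_def)
  then show ?thesis by blast
qed

text \<open>Both eigenvalues in the denominator belong to positive definite matrices. For \<open>R_I\<close> this is the
Stein equation for \<open>A\<^sup>d\<close>; the sum dominates its term with index 0, which is the identity.\<close>

lemma a_bound_pos: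
  fixes A :: "real^'n^'n"
  assumes "spec_radius A < 1" "\<beta> > 0"
  shows "0 < a_bound A \<beta>"
proof -
  let ?d = "CARD('n)" and ?C = "cmat A"
  have d: "0 < ?d" by simp
  have "(\<lambda>k. matpow (matpow ?C ?d) k *v v) \<longlonglongrightarrow> 0" for v
    using LIMSEQ_subseq_LIMSEQ[OF matpow_orbit_tendsto_0[OF assms(1), of v], of "\<lambda>k. ?d * k"] d
    by (simp add: matpow_mult o_def strict_mono_def)
  then have "(\<lambda>k. matpow (cmat (matpow A ?d)) k *v v) \<longlonglongrightarrow> 0" for v
    by (simp add: cmat_matpow)
  from stein_equation_unique_solution[OF refl this]
  have "\<exists>!R. pd R \<and> R - matpow (transpose ?C) ?d ** R ** matpow ?C ?d = mat 1"
    by (simp add: cmat_matpow matpow_transpose)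
  from theI'[OF this] have "pd (R_I A)" unfolding R_I_def by blast
  moreover have "pd (\<Sum>j<?d. matpow (transpose ?C) j ** matpow ?C j)"
  proof -
    let ?T = "\<lambda>j. matpow (transpose ?C) j ** matpow ?C j"
    have Teq: "?T j = transpose (cmat (matpow A j)) ** mat 1 ** cmat (matpow A j)" for j
      by (simp add: cmat_matpow matpow_transpose)
    have qT: "quadform (?T j) x = (norm (matpow ?C j *v x))\<^sup>2" for j x
      unfolding Teq quadform_conjugate quadform_mat_1 by (simp add: cmat_matpow)
    have herm: "hermitian (sum ?T J)" for J
    proof (induction J rule: infinite_finite_induct)
      case (insert j J)
      then show ?case by (simp add: hermitian_add Teq hermitian_conjugate hermitian_mat_1 del: matrix_mul_rid)
    qed (simp_all add: hermitian_def)
    have quad: "quadform (sum ?T J) x = (\<Sum>j\<in>J. (norm (matpow ?C j *v x))\<^sup>2)" for J x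
    proof (induction J rule: infinite_finite_induct)
      case (insert j J)
      then show ?case
        by (simp add: quadform_add qT)
    qed (simp_all add: quadform_inner)
    have "0 < quadform (sum ?T {..<?d}) x" if "x \<noteq> 0" for x
    proof -
      have "(norm x)\<^sup>2 \<le> (\<Sum>j<?d. (norm (matpow ?C j *v x))\<^sup>2)"
        using member_le_sum[of 0 "{..<?d}" "\<lambda>j. (norm (matpow ?C j *v x))\<^sup>2"] d by simp
      moreover have "0 < (norm x)\<^sup>2" using that by simp
      ultimately show ?thesis unfolding quad by linarith
    qed
    then show ?thesis using herm by (simp add: pd_def)
  qed
  ultimately show ?thesis
    using assms(2) by (simp add: a_bound_def lambda_max_pos)
qed

section \<open>Variational formulas\<close>

lemma quadform_pos: "pd P \<Longrightarrow> x \<noteq> 0 \<Longrightarrow> 0 < quadform P x"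
  by (simp add: pd_def)

lemma quadform_nonneg: "pd P \<Longrightarrow> 0 \<le> quadform P x"
  using pd_imp_psd psd_def by blast

text \<open>With \<open>S = P\<^sup>-\<^sup>1\<^sup>/\<^sup>2\<close> the substitution \<open>y = S x\<close> turns the form of \<open>P\<close> into the squared norm, and it
reaches every \<open>y\<close>.\<close>

lemma quadform_sqrt_conjugate:
  assumes P: "pd P"
  shows "quadform P (inv_sqrt P *v x) = (norm x)\<^sup>2" "\<exists>x. y = inv_sqrt P *v x"
proof -
  let ?S = "inv_sqrt P"
  have S: "pd ?S" "?S ** ?S = matrix_inv P" by (rule inv_sqrt_properties[OF P])+
  have 1: "?S ** (?S ** P) = mat 1"
    by (simp add: matrix_mul_assoc S(2) pd_inverse(2)[OF P])
  then have 2: "(?S ** P) ** ?S = mat 1" using matrix_left_right_inverse by blast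
  have "quadform P (?S *v x) = x \<bullet> (((?S ** P) ** ?S) *v x)"
    using hermitianD[of ?S x "P *v (?S *v x)"] S(1)
    by (simp add: pd_def quadform_inner matrix_vector_mul_assoc matrix_mul_assoc)
  then show "quadform P (?S *v x) = (norm x)\<^sup>2" by (simp add: 2 power2_norm_eq_inner)
  have "y = ?S *v ((?S ** P) *v y)" by (simp add: matrix_vector_mul_assoc 1)
  then show "\<exists>x. y = ?S *v x" by blast
qed

text \<open>Under the substitution \<open>y = P\<^sup>-\<^sup>1\<^sup>/\<^sup>2 x\<close> the largest eigenvalue of \<open>P\<^sup>-\<^sup>1\<^sup>/\<^sup>2 Q P\<^sup>-\<^sup>1\<^sup>/\<^sup>2\<close> becomes
the maximal generalized Rayleigh quotient of \<open>Q\<close> and \<open>P\<close>. In this form the square root has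
disappeared, and the dependence on \<open>P\<close> is visibly continuous.\<close>

lemma lambda_max_rayleigh:
  fixes Q :: "real^'n^'n"
  assumes P: "pd P" and Q: "transpose Q = Q"
  defines "L \<equiv> lambda_max (inv_sqrt P ** cmat Q ** inv_sqrt P)"
  shows "quadform (cmat Q) y \<le> L * quadform P y"
    "L = (SUP x\<in>sphere 0 1. quadform (cmat Q) x / quadform P x)"
proof -
  let ?S = "inv_sqrt P"
  let ?N = "?S ** cmat Q ** ?S"
  have hS: "hermitian ?S" using inv_sqrt_properties(1)[OF P] by (simp add: pd_def)
  have form: "x \<bullet> (?N *v y) = (?S *v x) \<bullet> (cmat Q *v (?S *v y))" for x y
    using hermitianD[OF hS, of x "cmat Q *v (?S *v y)"]
    by (simp add: matrix_vector_mul_assoc matrix_mul_assoc)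
  have "x \<bullet> (?N *v y) = (?N *v x) \<bullet> y" for x y
    using form[of x y] form[of y x] hermitianD[OF hermitian_cmat[OF Q], of "?S *v x" "?S *v y"]
    by (simp add: inner_commute)
  then have hN: "hermitian ?N" by (simp add: hermitian_iff_self_adjoint)
  have qN: "quadform ?N x = quadform (cmat Q) (?S *v x)" for x
    using form by (simp add: quadform_inner)
  obtain x0 where x0: "norm x0 = 1" "L = quadform ?N x0"
    "\<And>y. quadform ?N y \<le> L * (norm y)\<^sup>2"
    unfolding L_def using lambda_max_attained[OF hN] by blast
  have le: "quadform (cmat Q) y \<le> L * quadform P y" for y
  proof -
    obtain x where x: "y = ?S *v x" using quadform_sqrt_conjugate(2)[OF P] by blast
    show ?thesis using x0(3)[of x] by (simp add: x quadform_sqrt_conjugate(1)[OF P] qN)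
  qed
  then show "quadform (cmat Q) y \<le> L * quadform P y" .
  let ?y = "?S *v x0"
  have "quadform P ?y = 1" by (simp add: quadform_sqrt_conjugate(1)[OF P] x0(1))
  then have y0: "?y \<noteq> 0" and Leq: "L = quadform (cmat Q) ?y / quadform P ?y"
    by (auto simp: quadform_inner x0(2) qN[unfolded quadform_inner])
  let ?u = "?y /\<^sub>R norm ?y"
  have "L = quadform (cmat Q) ?u / quadform P ?u"
    using y0 unfolding quadform_scaleR_vec Leq by simp
  moreover have "?u \<in> sphere 0 1" using y0 by simp
  ultimately have mem: "L \<in> (\<lambda>x. quadform (cmat Q) x / quadform P x) ` sphere 0 1" by blast
  have ub: "quadform (cmat Q) x / quadform P x \<le> L" if "x \<in> sphere 0 1" for x
  proof -
    have "x \<noteq> 0" using that by auto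
    then show ?thesis using le[of x] quadform_pos[OF P, of x] by (simp add: field_simps)
  qed
  show "L = (SUP x\<in>sphere 0 1. quadform (cmat Q) x / quadform P x)"
    using mem ub by (intro cSup_eq_maximum[symmetric]) auto
qed

lemma dual_norm_P_bound:
  assumes P: "pd P"
  shows "y \<bullet> x \<le> dual_norm_P P y * norm_P P x"
proof -
  let ?N = "matrix_inv P"
  have PN: "P *v (?N *v y) = y" by (simp add: matrix_vector_mul_assoc pd_inverse(1)[OF P])
  have hP: "hermitian P" using P by (simp add: pd_def)
  have "(x \<bullet> y)\<^sup>2 \<le> quadform P x * quadform P (?N *v y)"
    using psd_cauchy_schwarz[OF pd_imp_psd[OF P], of x "?N *v y"] by (simp add: PN)
  also have "quadform P (?N *v y) = quadform ?N y"
    by (simp add: quadform_inner PN inner_commute)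
  finally have "\<bar>x \<bullet> y\<bar> \<le> sqrt (quadform P x * quadform ?N y)"
    using real_sqrt_le_mono by fastforce
  then show ?thesis
    by (simp add: dual_norm_P_def norm_P_def real_sqrt_mult inner_commute mult.commute)
qed

lemma norm_P_pos: "pd P \<Longrightarrow> x \<noteq> 0 \<Longrightarrow> 0 < norm_P P x"
  by (simp add: norm_P_def quadform_pos)

lemma norm_P_nonneg: "pd P \<Longrightarrow> 0 \<le> norm_P P x"
  by (simp add: norm_P_def quadform_nonneg)

lemma norm_P_scaleR: "norm_P P (c *\<^sub>R x) = \<bar>c\<bar> * norm_P P x"
  by (simp add: norm_P_def quadform_scaleR_vec real_sqrt_mult)

lemma dual_norm_P_pos: "pd P \<Longrightarrow> y \<noteq> 0 \<Longrightarrow> 0 < dual_norm_P P y"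
  by (simp add: dual_norm_P_def quadform_pos pd_inverse)

lemma dual_norm_P_nonneg: "pd P \<Longrightarrow> 0 \<le> dual_norm_P P y"
  by (simp add: dual_norm_P_def quadform_nonneg pd_inverse)

text \<open>The bound \<open>dual_norm_P_bound\<close> is attained in the direction of \<open>x = P\<^sup>-\<^sup>1 y\<close>. This formula
replaces the matrix inverse by a supremum of functions continuous in \<open>P\<close>.\<close>

lemma dual_norm_P_eq_SUP:
  assumes P: "pd P"
  shows "dual_norm_P P y = (SUP x\<in>sphere 0 1. (y \<bullet> x) / norm_P P x)"
proof -
  have ub: "(y \<bullet> x) / norm_P P x \<le> dual_norm_P P y" if "x \<in> sphere 0 1" for x
  proof -
    have "x \<noteq> 0" using that by auto
    then show ?thesis using dual_norm_P_bound[OF P, of y x] norm_P_pos[OF P, of x]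
      by (simp add: field_simps)
  qed
  have "dual_norm_P P y \<in> (\<lambda>x. (y \<bullet> x) / norm_P P x) ` sphere 0 1"
  proof (cases "y = 0")
    case True
    obtain x :: "complex^'a" where "norm x = 1" using vector_choose_size[of 1] by auto
    then show ?thesis using True by (auto simp: dual_norm_P_def quadform_inner intro!: rev_image_eqI[of x])
  next
    case False
    let ?N = "matrix_inv P" 
    let ?z = "?N *v y"
    let ?u = "?z /\<^sub>R norm ?z"
    have PN: "P *v ?z = y" by (simp add: matrix_vector_mul_assoc pd_inverse(1)[OF P])
    then have z0: "?z \<noteq> 0" using False by auto
    have nz: "norm_P P ?z = dual_norm_P P y"
      by (simp add: norm_P_def dual_norm_P_def quadform_inner PN inner_commute)
    have "y \<bullet> ?z = (dual_norm_P P y)\<^sup>2"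
      using quadform_nonneg[OF pd_inverse(3)[OF P], of y] by (simp add: dual_norm_P_def quadform_inner)
    then have "dual_norm_P P y = (y \<bullet> ?u) / norm_P P ?u"
      using z0 dual_norm_P_pos[OF P False] unfolding norm_P_scaleR nz
      by (simp add: power2_eq_square)
    moreover have "?u \<in> sphere 0 1" using z0 by simp
    ultimately show ?thesis by (rule image_eqI)
  qed
  with ub show ?thesis by (intro cSup_eq_maximum[symmetric]) auto
qed

lemma matnorm_P_eq_SUP:
  "matnorm_P P A = (SUP x\<in>sphere 0 1. norm_P P (cmat A *v x) / norm_P P x)"
proof -
  let ?f = "\<lambda>x. norm_P P (cmat A *v x) / norm_P P x"
  have "?f ` {x. x \<noteq> 0} = ?f ` sphere 0 1"
  proof safe
    fix x :: "complex^'a" assume "x \<noteq> 0"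
    then have "?f x = ?f (x /\<^sub>R norm x)" "x /\<^sub>R norm x \<in> sphere 0 1"
      by (simp_all add: matrix_vector_scaleR norm_P_scaleR)
    then show "?f x \<in> ?f ` sphere 0 1" by (rule image_eqI)
  next
    fix x :: "complex^'a" assume "x \<in> sphere 0 1"
    then have "x \<noteq> 0" by auto
    then show "?f x \<in> ?f ` {x. x \<noteq> 0}" by blast
  qed
  then show ?thesis by (simp add: matnorm_P_def)
qed

section \<open>Continuity of suprema over compact sets\<close>

text \<open>On \<open>S \<times> K\<close> the function is uniformly continuous, so moving \<open>p\<close> slightly changes all values \<open>f p x\<close>,
and hence their supremum, by little.\<close>

lemma continuous_on_SUP_compact:
  fixes f :: "'a::metric_space \<Rightarrow> 'b::metric_space \<Rightarrow> real"
  assumes S: "compact S" and K: "compact K" "K \<noteq> {}"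
    and f: "continuous_on (S \<times> K) (\<lambda>z. f (fst z) (snd z))"
  shows "continuous_on S (\<lambda>p. SUP x\<in>K. f p x)"
proof (rule continuous_on_iff[THEN iffD2], intro ballI allI impI)
  fix p e assume p: "p \<in> S" and e: "(0::real) < e"
  have "uniformly_continuous_on (S \<times> K) (\<lambda>z. f (fst z) (snd z))"
    by (intro compact_uniformly_continuous f compact_Times S K)
  then obtain d where d: "d > 0"
    "\<And>z z'. z \<in> S \<times> K \<Longrightarrow> z' \<in> S \<times> K \<Longrightarrow> dist z' z < d \<Longrightarrow>
       dist (f (fst z') (snd z')) (f (fst z) (snd z)) < e / 2"
    unfolding uniformly_continuous_on_def using e by (metis half_gt_zero)
  have bdd: "bdd_above (f p ` K)" if "p \<in> S" for p
  proof (rule bdd_above_compact_image[OF K(1)])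
    have "continuous_on K (\<lambda>x. (p, x))" by (intro continuous_intros)
    then show "continuous_on K (f p)"
      using continuous_on_compose2[OF f, of K "\<lambda>x. (p, x)"] that by auto
  qed
  have le: "(SUP x\<in>K. f p x) \<le> (SUP x\<in>K. f p' x) + e / 2"
    if "p \<in> S" "p' \<in> S" "dist p p' < d" for p p'
  proof (rule cSUP_least[OF K(2)])
    fix x assume x: "x \<in> K"
    have "dist (f p x) (f p' x) < e / 2"
      using d(2)[of "(p', x)" "(p, x)"] that x by (simp add: dist_Pair_Pair)
    then have "f p x \<le> f p' x + e / 2" unfolding dist_real_def by linarith
    also have "f p' x \<le> (SUP x\<in>K. f p' x)" using bdd[OF that(2)] x by (intro cSUP_upper)
    finally show "f p x \<le> (SUP x\<in>K. f p' x) + e / 2" by simp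
  qed
  \<comment> \<open>The one-sided estimate is symmetric in the two points.\<close>
  show "\<exists>d>0. \<forall>p'\<in>S. dist p' p < d \<longrightarrow> dist (SUP x\<in>K. f p' x) (SUP x\<in>K. f p x) < e"
  proof (intro exI conjI ballI impI)
    fix p' assume p': "p' \<in> S" "dist p' p < d"
    show "dist (SUP x\<in>K. f p' x) (SUP x\<in>K. f p x) < e"
      using le[OF p p'(1)] le[OF p'(1) p] p'(2) e
      by (simp add: dist_real_def dist_commute abs_less_iff)
  qed (rule d(1))
qed

lemma continuous_on_cvec: "continuous_on K cvec"
  unfolding cvec_def by (intro continuous_on_vec_lambda continuous_intros)

lemma continuous_on_mu:
  assumes "compact S" "compact X" "X \<noteq> {}"
  shows "continuous_on S (mu X)"
  unfolding mu_def
  by (intro continuous_on_SUP_compact assms continuous_intros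
      continuous_on_compose2[OF continuous_on_cvec[of UNIV]]) auto

context
  fixes S :: "(complex^'n^'n) set"
  assumes S: "compact S" "\<And>P. P \<in> S \<Longrightarrow> pd P"
begin

lemma quadform_pos_on_sphere: "z \<in> S \<times> sphere 0 1 \<Longrightarrow> 0 < quadform (fst z) (snd z)"
  using S(2) by (auto intro!: quadform_pos)

lemma continuous_on_sphere_SUP:
  fixes f :: "complex^'n^'n \<Rightarrow> complex^'n \<Rightarrow> real"
  assumes "continuous_on (S \<times> sphere 0 1) (\<lambda>z. f (fst z) (snd z))"
  shows "continuous_on S (\<lambda>P. SUP x\<in>sphere 0 1. f P x)"
  using S(1) assms by (intro continuous_on_SUP_compact) auto

lemma continuous_on_t_star:
  assumes "transpose Q = Q"
  shows "continuous_on S (t_star Q)"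
proof -
  have "continuous_on S (\<lambda>P. SUP x\<in>sphere 0 1. quadform (cmat Q) x / quadform P x)"
    by (intro continuous_on_sphere_SUP continuous_intros) (metis quadform_pos_on_sphere less_irrefl)
  then have "continuous_on S (\<lambda>P. lambda_max (inv_sqrt P ** cmat Q ** inv_sqrt P))"
    by (rule continuous_on_eq) (simp add: lambda_max_rayleigh(2) S assms)
  then show ?thesis
    unfolding t_star_def[abs_def] by (intro continuous_intros)
qed

lemma continuous_on_dual_norm_P: "continuous_on S (\<lambda>P. dual_norm_P P y)"
proof -
  have "continuous_on S (\<lambda>P. SUP x\<in>sphere 0 1. (y \<bullet> x) / norm_P P x)"
    unfolding norm_P_def
    by (intro continuous_on_sphere_SUP continuous_intros)
       (metis quadform_pos_on_sphere less_irrefl real_sqrt_eq_zero_cancel_iff)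
  then show ?thesis
    by (rule continuous_on_eq) (simp add: dual_norm_P_eq_SUP S)
qed

lemma continuous_on_matnorm_P: "continuous_on S (\<lambda>P. matnorm_P P A)"
  unfolding matnorm_P_eq_SUP norm_P_def
  by (intro continuous_on_sphere_SUP continuous_intros)
     (metis quadform_pos_on_sphere less_irrefl real_sqrt_eq_zero_cancel_iff)

end

section \<open>The function \<open>H\<close> and its inverse\<close>

text \<open>Expanding the square removes the case distinction in \<open>H\<close>.\<close>

lemma H_expand:
  assumes "0 \<le> mu X P" "0 \<le> t"
  shows "H q X P t x = t * mu X P * x\<^sup>2 + sqrt (mu X P) * dual_norm_P P (cvec q) * x"
proof (cases "t = 0")
  case False
  then have t: "t > 0" using assms(2) by simp
  define D where "D = dual_norm_P P (cvec q)"
  have r: "sqrt t * sqrt t = t" "sqrt (mu X P) * sqrt (mu X P) = mu X P"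
    using t assms by simp_all
  have "sqrt t > 0" using t by simp
  then have "2 * (sqrt t * sqrt (mu X P) * x) * (D / (2 * sqrt t)) = sqrt (mu X P) * D * x"
    by simp
  moreover have "(sqrt t * sqrt (mu X P) * x)\<^sup>2 = t * mu X P * x\<^sup>2"
    using t assms(1) by (simp add: power_mult_distrib)
  moreover have "(D / (2 * sqrt t))\<^sup>2 = D\<^sup>2 / (4 * t)"
    using t by (simp add: power_divide power_mult_distrib)
  ultimately show ?thesis
    using False by (simp add: H_def real_sqrt_mult power2_sum D_def)
qed (simp add: H_def mult_ac)

lemma H_strict_mono:
  assumes m: "0 < mu X P" and t: "0 \<le> t" and D: "0 \<le> dual_norm_P P (cvec q)"
    and pos: "0 < t \<or> 0 < dual_norm_P P (cvec q)" and xy: "0 \<le> x" "x < y"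
  shows "H q X P t x < H q X P t y"
proof -
  let ?D = "dual_norm_P P (cvec q)"
  have sq: "x\<^sup>2 < y\<^sup>2" using xy by (simp add: power_strict_mono)
  have 1: "t * mu X P * x\<^sup>2 \<le> t * mu X P * y\<^sup>2"
    using m t sq by (intro mult_left_mono) auto
  have 2: "sqrt (mu X P) * ?D * x \<le> sqrt (mu X P) * ?D * y"
    using m D xy by (intro mult_left_mono) auto
  from pos have "t * mu X P * x\<^sup>2 < t * mu X P * y\<^sup>2 \<or> sqrt (mu X P) * ?D * x < sqrt (mu X P) * ?D * y"
    using m sq xy by auto
  with 1 2 show ?thesis unfolding H_expand[OF less_imp_le[OF m] t] by linarith
qed

text \<open>The value \<open>w = \<surd>\<mu> h\<close> solves \<open>t w\<^sup>2 + D w = v\<close>. Rationalizing the numerator of the usual root formula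
gives \<open>w = 2 v / (r + D)\<close> with \<open>r = \<surd>(4 t v + D\<^sup>2)\<close>, which has no division by \<open>t\<close>.\<close>

lemma H_inv_eq:
  assumes m: "0 < mu X P" and t: "0 \<le> t" and D: "0 \<le> dual_norm_P P (cvec q)"
    and pos: "0 < t \<or> 0 < dual_norm_P P (cvec q)" and v: "0 < v"
  defines "h \<equiv> 2 * v / (sqrt (mu X P) * (sqrt (4 * t * v + (dual_norm_P P (cvec q))\<^sup>2) + dual_norm_P P (cvec q)))"
  shows "H_inv q X P t v = h" "0 < h" "H q X P t h = v"
proof -
  define D where "D = dual_norm_P P (cvec q)"
  define r where "r = sqrt (4 * t * v + D\<^sup>2)"
  have arg: "0 < 4 * t * v + D\<^sup>2"
  proof (cases "0 < t")
    case True
    then have "0 < 4 * t * v" using v by simp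
    then show ?thesis by (simp add: add_pos_nonneg)
  next
    case False
    then show ?thesis using pos t v by (simp add: D_def)
  qed
  then have r: "0 < r" "r\<^sup>2 = 4 * t * v + D\<^sup>2" by (simp_all add: r_def)
  have rD: "0 < r + D" using r(1) assms(3) by (simp add: D_def)
  have h: "h = 2 * v / (sqrt (mu X P) * (r + D))" by (simp add: h_def r_def D_def)
  show h0: "0 < h" using rD m v by (simp add: h)
  define w where "w = 2 * v / (r + D)"
  have hw: "sqrt (mu X P) * h = w" using m by (simp add: h w_def)
  have "H q X P t h = t * (sqrt (mu X P) * h)\<^sup>2 + D * (sqrt (mu X P) * h)"
    using m t by (simp add: H_expand D_def power_mult_distrib)
  also have "\<dots> = t * w\<^sup>2 + D * w" by (simp add: hw)
  also have "\<dots> = v"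
  proof -
    have "(t * w\<^sup>2 + D * w) * (r + D)\<^sup>2 = t * (w * (r + D))\<^sup>2 + D * (w * (r + D)) * (r + D)"
      by (simp add: power2_eq_square algebra_simps)
    also have "w * (r + D) = 2 * v" using rD by (simp add: w_def)
    also have "t * (2 * v)\<^sup>2 + D * (2 * v) * (r + D) = v * (4 * t * v + 2 * D * r + 2 * D\<^sup>2)"
      by (simp add: power2_eq_square algebra_simps)
    also have "\<dots> = v * (r + D)\<^sup>2" using r(2) by (simp add: power2_sum algebra_simps)
    finally show ?thesis using rD by simp
  qed
  finally show Hh: "H q X P t h = v" .
  have "inj_on (H q X P t) {0..}"
  proof (rule linorder_inj_onI')
    fix x y :: real assume "x \<in> {0..}" "y \<in> {0..}" "x < y"
    then show "H q X P t x \<noteq> H q X P t y"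
      using H_strict_mono[OF m t assms(3) pos, of x y] by simp
  qed
  then show "H_inv q X P t v = h"
    unfolding H_inv_def using Hh h0 by (intro inv_into_f_eq) auto
qed

section \<open>The feasible set\<close>

lemma lyap_pd: "P \<in> lyap A \<Longrightarrow> pd P"
  by (simp add: lyap_def)

lemma C_set_coercive:
  assumes "P \<in> C_set A \<alpha> \<beta>"
  shows "\<alpha> * (norm x)\<^sup>2 \<le> quadform P x - quadform P (cmat A *v x)"
    "quadform P x \<le> \<beta> * (norm x)\<^sup>2" "psd P"
  using assms
  by (auto simp: C_set_def psd_def quadform_diff quadform_scaleR quadform_mat_1 quadform_conjugate)

text \<open>The inequality \<open>P - A\<^sup>T P A \<ge> \<alpha> I\<close> with \<open>P \<ge> 0\<close> gives \<open>P \<ge> \<alpha> I\<close>, so strictness is automatic.\<close>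

lemma C_set_subset_lyap:
  assumes "\<alpha> > 0"
  shows "C_set A \<alpha> \<beta> \<subseteq> lyap A"
proof
  fix P assume P: "P \<in> C_set A \<alpha> \<beta>"
  then have h: "hermitian P" and psd: "\<And>x. 0 \<le> quadform P x" by (auto simp: C_set_def psd_def)
  have "0 < quadform P x - quadform P (cmat A *v x)" if "x \<noteq> 0" for x
  proof -
    have "0 < \<alpha> * (norm x)\<^sup>2" using assms that by simp
    then show ?thesis using C_set_coercive(1)[OF P, of x] by linarith
  qed
  moreover from this have "0 < quadform P x" if "x \<noteq> 0" for x
    using that psd[of "cmat A *v x"] by fastforce
  ultimately show "P \<in> lyap A"
    using h by (simp add: lyap_def pd_def quadform_diff quadform_conjugate hermitian_diff hermitian_conjugate)
qed

lemma closed_psd_preimage: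
  fixes f :: "complex^'n^'n \<Rightarrow> complex^'m^'m"
  assumes f: "continuous_on UNIV f"
  shows "closed {P. psd (f P)}"
  unfolding psd_def hermitian_iff_self_adjoint
  by (intro closed_Collect_conj closed_Collect_all closed_Collect_eq closed_Collect_le
      continuous_intros continuous_on_compose2[OF f]) auto

text \<open>Boundedness is due to \<open>P \<le> \<beta> I\<close>: for positive semidefinite \<open>P\<close> it bounds the operator norm, and thus
every entry, by \<open>\<beta>\<close>.\<close>

lemma compact_C_set: "compact (C_set A \<alpha> \<beta>)"
proof -
  have mult: "continuous_on UNIV (\<lambda>P. transpose (cmat A) ** P ** cmat A)"
  proof (rule linear_continuous_on, rule linear_conv_bounded_linear[THEN iffD1], rule linearI)
    fix c and P R :: "complex^'a^'a"
    show "transpose (cmat A) ** (P + R) ** cmat A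
        = transpose (cmat A) ** P ** cmat A + transpose (cmat A) ** R ** cmat A"
      "transpose (cmat A) ** (c *\<^sub>R P) ** cmat A = c *\<^sub>R (transpose (cmat A) ** P ** cmat A)"
      by (simp_all add: matrix_eq matrix_vector_mul_assoc[symmetric] matrix_scaleR_vector
         matrix_vector_scaleR matrix_vector_mult_add_rdistrib
         matrix_vector_right_distrib del: transpose_matrix_vector)
  qed
  have eq: "C_set A \<alpha> \<beta> = {P. psd P} \<inter> {P. psd (P - transpose (cmat A) ** P ** cmat A - \<alpha> *\<^sub>R mat 1)}
      \<inter> {P. psd (\<beta> *\<^sub>R mat 1 - P)}"
    by (auto simp: C_set_def psd_def)
  have "closed (C_set A \<alpha> \<beta>)"
    unfolding eq by (intro closed_Int closed_psd_preimage continuous_intros mult)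
  moreover have "bounded (C_set A \<alpha> \<beta>)"
  proof (rule boundedI)
    fix P assume P: "P \<in> C_set A \<alpha> \<beta>"
    have col: "norm (P *v axis j 1) \<le> \<beta>" for j
      using psd_norm_bound[OF C_set_coercive(3,2)[OF P], of "axis j 1"] by simp
    have entry: "norm (P $ i $ j) \<le> \<beta>" for i j
    proof -
      have "P $ i $ j = (P *v axis j 1) $ i"
        by (simp add: matrix_vector_mult_def axis_def if_distrib cong: if_cong)
      then show ?thesis using Finite_Cartesian_Product.norm_nth_le[of "P *v axis j 1" i] col[of j]
        by (metis order.trans)
    qed
    have "norm P \<le> (\<Sum>i\<in>UNIV. norm (P $ i))" 
      unfolding norm_vec_def[of P] by (rule L2_set_le_sum) simp
    also have "\<dots> \<le> (\<Sum>i\<in>UNIV. \<Sum>j\<in>UNIV. norm (P $ i $ j))"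
      by (intro sum_mono, subst norm_vec_def) (rule L2_set_le_sum, simp)
    also have "\<dots> \<le> (\<Sum>i\<in>(UNIV::'a set). \<Sum>j\<in>(UNIV::'a set). \<beta>)"
      by (intro sum_mono entry)
    finally show "norm P \<le> (\<Sum>i\<in>(UNIV::'a set). \<Sum>j\<in>(UNIV::'a set). \<beta>)" .
  qed
  ultimately show ?thesis by (simp add: compact_eq_bounded_closed)
qed

section \<open>The Lyapunov bound on the maxima\<close>

text \<open>The operator norm is attained at some unit vector, where the strict inequality \<open>P - A\<^sup>T P A > 0\<close> keeps
it below 1.\<close>

lemma matnorm_P_bounds:
  assumes P: "P \<in> lyap A" and A: "A \<noteq> 0"
  shows "0 < matnorm_P P A" "matnorm_P P A < 1"
    "quadform P (cmat A *v x) \<le> (matnorm_P P A)\<^sup>2 * quadform P x"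
proof -
  let ?f = "\<lambda>x. norm_P P (cmat A *v x) / norm_P P x"
  have pd: "pd P" and dec: "\<And>x. x \<noteq> 0 \<Longrightarrow> quadform P (cmat A *v x) < quadform P x"
    using P by (auto simp: lyap_def pd_def quadform_diff quadform_conjugate)
  have pos: "0 < quadform P x" if "x \<in> sphere 0 1" for x
    using that by (intro quadform_pos[OF pd]) auto
  have cont: "continuous_on (sphere 0 1) ?f"
    unfolding norm_P_def
    by (intro continuous_intros ballI) (metis pos less_irrefl real_sqrt_eq_zero_cancel_iff)
  have "sphere (0::complex^'a) 1 \<noteq> {}" by auto
  then obtain x0 where x0: "norm x0 = 1" "\<And>x. norm x = 1 \<Longrightarrow> ?f x \<le> ?f x0"
    using continuous_attains_sup[OF _ _ cont] by auto
  have n: "matnorm_P P A = ?f x0"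
    unfolding matnorm_P_eq_SUP using x0 by (intro cSup_eq_maximum) auto
  have x00: "x0 \<noteq> 0" using x0(1) by auto
  have "norm_P P (cmat A *v x0) < norm_P P x0"
    using dec[OF x00] by (simp add: norm_P_def)
  then show "matnorm_P P A < 1" using norm_P_pos[OF pd x00] by (simp add: n)
  have bound: "norm_P P (cmat A *v x) \<le> matnorm_P P A * norm_P P x" for x
  proof (cases "x = 0")
    case False
    let ?u = "x /\<^sub>R norm x"
    have "?f x = ?f ?u" using False by (simp add: matrix_vector_scaleR norm_P_scaleR)
    also have "\<dots> \<le> matnorm_P P A" unfolding n using False by (intro x0(2)) simp
    finally show ?thesis using norm_P_pos[OF pd False] by (simp add: field_simps)
  qed (simp add: norm_P_def quadform_inner)
  obtain w where w: "A *v w \<noteq> 0" using A by (metis matrix_eq matrix_vector_mult_0)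
  then have "cmat A *v cvec w \<noteq> 0" by (simp add: cmat_cvec cvec_eq_0_iff)
  then have "0 < norm_P P (cmat A *v cvec w)" by (rule norm_P_pos[OF pd])
  also have "\<dots> \<le> matnorm_P P A * norm_P P (cvec w)" by (rule bound)
  finally show pos: "0 < matnorm_P P A"
    using norm_P_nonneg[OF pd, of "cvec w"] by (simp add: zero_less_mult_iff)
  have "(norm_P P (cmat A *v x))\<^sup>2 \<le> (matnorm_P P A * norm_P P x)\<^sup>2"
    using norm_P_nonneg[OF pd] bound by (intro power_mono) auto
  then show "quadform P (cmat A *v x) \<le> (matnorm_P P A)\<^sup>2 * quadform P x"
    using quadform_nonneg[OF pd] by (simp add: norm_P_def power_mult_distrib)
qed

lemma mu_upper:
  assumes "compact X" "x \<in> X"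
  shows "quadform P (cvec x) \<le> mu X P"
  unfolding mu_def
  by (intro cSUP_upper assms bdd_above_compact_image continuous_intros continuous_on_cvec)

lemma mu_pos:
  assumes "compact X" "X \<noteq> {}" "X \<noteq> {0}" "pd P"
  shows "0 < mu X P"
proof -
  obtain x where x: "x \<in> X" "x \<noteq> 0" using assms(2,3) by blast
  then have "0 < quadform P (cvec x)" using assms(4) by (simp add: quadform_pos cvec_eq_0_iff)
  then show ?thesis using mu_upper[OF assms(1) x(1), of P] by linarith
qed

lemma t_star_bound:
  assumes "pd P" "transpose Q = Q"
  shows "quadform (cmat Q) x \<le> t_star Q P * quadform P x" "0 \<le> t_star Q P"
proof -
  have "quadform (cmat Q) x \<le> lambda_max (inv_sqrt P ** cmat Q ** inv_sqrt P) * quadform P x"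
    by (rule lambda_max_rayleigh(1)[OF assms])
  also have "\<dots> \<le> t_star Q P * quadform P x"
    using quadform_nonneg[OF assms(1)] by (intro mult_right_mono) (simp_all add: t_star_def)
  finally show "quadform (cmat Q) x \<le> t_star Q P * quadform P x" .
qed (simp add: t_star_def)

lemma t_star_in_lyap_pairs:
  assumes "P \<in> lyap A" "transpose Q = Q"
  shows "(P, t_star Q P) \<in> lyap_pairs A Q"
  using assms t_star_bound[OF lyap_pd[OF assms(1)] assms(2)]
  by (auto simp: lyap_pairs_def T_set_def psd_def quadform_diff quadform_scaleR
      intro!: hermitian_diff hermitian_scaleR hermitian_cmat) (simp add: lyap_def)

text \<open>If \<open>t_star\<close> vanishes, then \<open>Q\<close> is negative semidefinite and the hypothesis makes \<open>q\<close> nonzero. This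
excludes the degenerate case in which \<open>H\<close> is identically 0.\<close>

lemma t_star_or_dual_pos:
  assumes "pd P" "transpose Q = Q" and q: "psd (- cmat Q) \<longrightarrow> q \<noteq> 0"
  shows "0 < t_star Q P \<or> 0 < dual_norm_P P (cvec q)"
proof (cases "t_star Q P = 0")
  case True
  then have "quadform (cmat Q) x \<le> 0" for x using t_star_bound(1)[OF assms(1,2), of x] by simp
  then have "psd (- cmat Q)"
    using hermitian_scaleR[OF hermitian_cmat[OF assms(2)], of "-1"]
    by (simp add: psd_def quadform_minus)
  then show ?thesis using q dual_norm_P_pos[OF assms(1)] by (simp add: cvec_eq_0_iff)
next
  case False
  then show ?thesis using t_star_bound(2)[OF assms(1,2)] by simp
qed

text \<open>For \<open>y = A\<^sup>k x\<close> with \<open>k \<ge> 1\<close>, the \<open>P\<close>-norm is at most \<open>\<parallel>A\<parallel>\<^sub>P \<surd>\<mu>\<close>. The quadratic part is bounded by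
\<open>t \<parallel>y\<parallel>\<^sub>P\<^sup>2\<close>, since \<open>t P - Q\<close> is positive semidefinite, and the linear part by Cauchy--Schwarz; the two
bounds add up to \<open>H \<parallel>A\<parallel>\<^sub>P\<close>.\<close>

lemma nu_le_H_matnorm:
  fixes A Q :: "real^'n^'n"
  assumes P: "P \<in> lyap A" and A: "A \<noteq> 0" and Q: "transpose Q = Q"
    and X: "compact X" "X \<noteq> {}" and k: "k \<noteq> 0"
  shows "nu A Q q X k \<le> H q X P (t_star Q P) (matnorm_P P A)"
  unfolding nu_def
proof (rule cSUP_least[OF X(2)])
  fix x assume x: "x \<in> X"
  let ?t = "t_star Q P" and ?n = "matnorm_P P A" and ?D = "dual_norm_P P (cvec q)" and ?C = "cmat A"
  have pd: "pd P" by (rule lyap_pd[OF P])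
  have n: "0 < ?n" "?n < 1" "\<And>x. quadform P (?C *v x) \<le> ?n\<^sup>2 * quadform P x"
    using matnorm_P_bounds[OF P A] by auto
  have decay: "quadform P (matpow ?C (Suc j) *v z) \<le> ?n\<^sup>2 * quadform P z" for j z
  proof (induction j)
    case 0
    then show ?case using n(3) by simp
  next
    case (Suc j)
    let ?w = "matpow ?C (Suc j) *v z"
    have "quadform P (?C *v ?w) \<le> ?n\<^sup>2 * quadform P ?w" by (rule n(3))
    also have "\<dots> \<le> 1 * quadform P ?w"
      using n quadform_nonneg[OF pd] by (intro mult_right_mono) (auto simp: power_le_one)
    finally show ?case using Suc by (simp add: matrix_vector_mul_assoc)
  qed
  obtain j where j: "k = Suc j" using k by (cases k) auto
  define y where "y = matpow A k *v x"
  have cy: "cvec y = matpow ?C k *v cvec x" by (simp add: y_def cmat_cvec[symmetric] cmat_matpow)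
  have m: "quadform P (cvec x) \<le> mu X P" by (rule mu_upper[OF X(1) x])
  have m0: "0 \<le> mu X P" using m quadform_nonneg[OF pd, of "cvec x"] by linarith
  have qy: "quadform P (cvec y) \<le> ?n\<^sup>2 * mu X P"
  proof -
    have "quadform P (cvec y) \<le> ?n\<^sup>2 * quadform P (cvec x)" unfolding cy j by (rule decay)
    also have "\<dots> \<le> ?n\<^sup>2 * mu X P" using m by (intro mult_left_mono) auto
    finally show ?thesis .
  qed
  have "x \<bullet> ((transpose (matpow A k) ** Q ** matpow A k) *v x) = y \<bullet> (Q *v y)"
    unfolding y_def
    by (simp add: matrix_vector_mul_assoc[symmetric] dot_lmul_matrix[symmetric] del: transpose_matrix_vector)
  also have "\<dots> = quadform (cmat Q) (cvec y)"
    by (simp add: quadform_inner cmat_cvec inner_cvec)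
  also have "\<dots> \<le> ?t * quadform P (cvec y)" by (rule t_star_bound(1)[OF pd Q])
  also have "\<dots> \<le> ?t * (?n\<^sup>2 * mu X P)" using qy t_star_bound(2)[OF pd Q] by (intro mult_left_mono)
  finally have 1: "x \<bullet> ((transpose (matpow A k) ** Q ** matpow A k) *v x) \<le> ?t * (?n\<^sup>2 * mu X P)" .
  have "q \<bullet> y = cvec q \<bullet> cvec y" by (simp add: inner_cvec)
  also have "\<dots> \<le> ?D * norm_P P (cvec y)" by (rule dual_norm_P_bound[OF pd])
  also have "\<dots> \<le> ?D * (?n * sqrt (mu X P))"
  proof (intro mult_left_mono dual_norm_P_nonneg[OF pd])
    have "norm_P P (cvec y) \<le> sqrt (?n\<^sup>2 * mu X P)" unfolding norm_P_def using qy by simp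
    then show "norm_P P (cvec y) \<le> ?n * sqrt (mu X P)" using n(1) by (simp add: real_sqrt_mult)
  qed
  finally have 2: "q \<bullet> y \<le> ?D * (?n * sqrt (mu X P))" .
  show "x \<bullet> ((transpose (matpow A k) ** Q ** matpow A k) *v x) + q \<bullet> (matpow A k *v x)
      \<le> H q X P ?t ?n"
    using 1 2 unfolding H_expand[OF m0 t_star_bound(2)[OF pd Q]] y_def by (simp add: mult_ac)
qed

section \<open>Scaling\<close>

lemma SUP_mult_compact:
  fixes f :: "'a::topological_space \<Rightarrow> real"
  assumes "compact K" "K \<noteq> {}" "continuous_on K f" "0 \<le> c"
  shows "(SUP x\<in>K. c * f x) = c * (SUP x\<in>K. f x)"
proof -
  obtain x0 where x0: "x0 \<in> K" "\<And>x. x \<in> K \<Longrightarrow> f x \<le> f x0"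
    using continuous_attains_sup[OF assms(1-3)] by blast
  have "(SUP x\<in>K. f x) = f x0"
    using x0 by (intro cSup_eq_maximum) auto
  moreover have "(SUP x\<in>K. c * f x) = c * f x0"
    using x0 assms(4) by (intro cSup_eq_maximum) (auto intro: mult_left_mono)
  ultimately show ?thesis by simp
qed

lemma mu_scaleR:
  assumes "compact X" "X \<noteq> {}" "0 \<le> c"
  shows "mu X (c *\<^sub>R P) = c * mu X P"
  unfolding mu_def quadform_scaleR
  by (intro SUP_mult_compact assms continuous_intros continuous_on_cvec)

lemma norm_P_scaleR_matrix: "0 \<le> c \<Longrightarrow> norm_P (c *\<^sub>R P) x = sqrt c * norm_P P x"
  by (simp add: norm_P_def quadform_scaleR real_sqrt_mult)

lemma matnorm_P_scaleR: "0 < c \<Longrightarrow> matnorm_P (c *\<^sub>R P) A = matnorm_P P A"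
  by (simp add: matnorm_P_def norm_P_scaleR_matrix)

lemma dual_norm_P_scaleR:
  assumes P: "pd P" and c: "0 < c"
  shows "dual_norm_P (c *\<^sub>R P) y = dual_norm_P P y / sqrt c"
proof -
  have pos: "quadform P x \<noteq> 0" if "x \<in> sphere 0 1" for x
    using that quadform_pos[OF P, of x] by force
  have "(SUP x\<in>sphere 0 1. (1 / sqrt c) * ((y \<bullet> x) / norm_P P x))
      = (1 / sqrt c) * (SUP x\<in>sphere 0 1. (y \<bullet> x) / norm_P P x)"
    unfolding norm_P_def using c
    by (intro SUP_mult_compact continuous_intros) (auto dest: pos)
  then show ?thesis
    using c by (simp add: dual_norm_P_eq_SUP P pd_scaleR norm_P_scaleR_matrix)
qed

lemma t_star_scaleR:
  assumes P: "pd P" and Q: "transpose Q = Q" and c: "0 < c"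
  shows "t_star Q (c *\<^sub>R P) = t_star Q P / c"
proof -
  have pos: "quadform P x \<noteq> 0" if "x \<in> sphere 0 1" for x
    using that quadform_pos[OF P, of x] by force
  have "(SUP x\<in>sphere 0 1. (1 / c) * (quadform (cmat Q) x / quadform P x))
      = (1 / c) * (SUP x\<in>sphere 0 1. quadform (cmat Q) x / quadform P x)"
    using c by (intro SUP_mult_compact continuous_intros) (auto dest: pos)
  then have "t_star Q (c *\<^sub>R P)
      = max ((1 / c) * (SUP x\<in>sphere 0 1. quadform (cmat Q) x / quadform P x)) 0"
    using c by (simp add: t_star_def lambda_max_rayleigh(2) P Q pd_scaleR quadform_scaleR)
  also have "\<dots> = t_star Q P / c"
    using c by (simp add: t_star_def lambda_max_rayleigh(2)[OF P Q] max_def divide_le_0_iff)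
  finally show ?thesis .
qed

section \<open>The objective function\<close>

context
  fixes A Q :: "real^'n^'n" and q :: "real^'n" and X :: "(real^'n) set" and k :: nat
  assumes Q: "transpose Q = Q"
    and X: "compact X" "X \<noteq> {}" "X \<noteq> {0}"
    and A: "A \<noteq> 0"
    and q: "psd (- cmat Q) \<longrightarrow> q \<noteq> 0"
    and nu_k: "0 < nu A Q q X k"
begin

lemma H_inv_t_star:
  assumes "pd P"
  defines "h \<equiv> 2 * nu A Q q X k / (sqrt (mu X P) *
     (sqrt (4 * t_star Q P * nu A Q q X k + (dual_norm_P P (cvec q))\<^sup>2) + dual_norm_P P (cvec q)))"
  shows "H_inv q X P (t_star Q P) (nu A Q q X k) = h" "0 < h" "H q X P (t_star Q P) h = nu A Q q X k"
  unfolding h_def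
  using H_inv_eq[OF mu_pos[OF X assms(1)] t_star_bound(2)[OF assms(1) Q]
    dual_norm_P_nonneg[OF assms(1)] t_star_or_dual_pos[OF assms(1) Q q] nu_k] by blast+

lemma continuous_on_H_inv:
  assumes S: "compact S" "S \<subseteq> lyap A"
  shows "continuous_on S (\<lambda>P. H_inv q X P (t_star Q P) (nu A Q q X k))"
proof -
  have pd: "pd P" if "P \<in> S" for P using that S(2) by (auto intro: lyap_pd)
  let ?v = "nu A Q q X k" and ?D = "\<lambda>P. dual_norm_P P (cvec q)"
  let ?den = "\<lambda>P. sqrt (mu X P) * (sqrt (4 * t_star Q P * ?v + (?D P)\<^sup>2) + ?D P)"
  have "?den P \<noteq> 0" if "P \<in> S" for P
    using H_inv_t_star(2)[OF pd[OF that]] by force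
  then have "continuous_on S (\<lambda>P. 2 * ?v / ?den P)"
    using S(1) pd Q X
    by (intro continuous_intros continuous_on_mu continuous_on_t_star continuous_on_dual_norm_P) auto
  then show ?thesis
    by (rule continuous_on_eq) (simp add: H_inv_t_star(1) pd)
qed

text \<open>Passing from \<open>P\<close> to \<open>c P\<close> multiplies \<open>\<surd>\<mu>\<close> by \<open>\<surd>c\<close>, divides \<open>D\<close> by \<open>\<surd>c\<close> and \<open>t\<close> by \<open>c\<close>, and leaves
the matrix norm unchanged; in the closed form of \<open>H_inv\<close> these factors cancel.\<close>

lemma G_scaleR:
  assumes P: "pd P" and c: "0 < c"
  shows "G A Q q X k (c *\<^sub>R P) = G A Q q X k P"
proof -
  let ?v = "nu A Q q X k" and ?D = "dual_norm_P P (cvec q)" and ?t = "t_star Q P"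
  have "sqrt (4 * (?t / c) * ?v + (?D / sqrt c)\<^sup>2) = sqrt ((4 * ?t * ?v + ?D\<^sup>2) / c)"
    using c by (simp add: power_divide add_divide_distrib)
  also have "\<dots> = sqrt (4 * ?t * ?v + ?D\<^sup>2) / sqrt c"
    by (rule real_sqrt_divide)
  finally have "sqrt (c * mu X P) * (sqrt (4 * (?t / c) * ?v + (?D / sqrt c)\<^sup>2) + ?D / sqrt c)
      = sqrt (mu X P) * (sqrt (4 * ?t * ?v + ?D\<^sup>2) + ?D)"
    using c by (simp add: real_sqrt_mult field_simps)
  then have "H_inv q X (c *\<^sub>R P) (t_star Q (c *\<^sub>R P)) ?v = H_inv q X P ?t ?v"
    using c unfolding H_inv_t_star(1)[OF P] H_inv_t_star(1)[OF pd_scaleR[OF P c]]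
    by (simp only: mu_scaleR[OF X(1,2) less_imp_le[OF c]] t_star_scaleR[OF P Q c] dual_norm_P_scaleR[OF P c])
  then show ?thesis using c by (simp add: G_def matnorm_P_scaleR)
qed

lemma H_inv_less_1:
  assumes P: "P \<in> lyap A" and nu_0: "nu A Q q X 0 < H q X P (t_star Q P) 1"
  shows "H_inv q X P (t_star Q P) (nu A Q q X k) < 1"
proof -
  have pd: "pd P" by (rule lyap_pd[OF P])
  let ?H = "H q X P (t_star Q P)" and ?h = "H_inv q X P (t_star Q P) (nu A Q q X k)"
  note mono = H_strict_mono[OF mu_pos[OF X pd] t_star_bound(2)[OF pd Q]
      dual_norm_P_nonneg[OF pd] t_star_or_dual_pos[OF pd Q q]]
  have "nu A Q q X k < ?H 1"
  proof (cases "k = 0")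
    case False
    have "nu A Q q X k \<le> ?H (matnorm_P P A)"
      by (rule nu_le_H_matnorm[OF P A Q X(1,2) False])
    also have "\<dots> < ?H 1"
      using matnorm_P_bounds[OF P A] by (intro mono) auto
    finally show ?thesis .
  qed (use nu_0 in simp)
  then have "?H ?h < ?H 1" using H_inv_t_star[OF pd] by simp
  then show ?thesis using mono[of 1 ?h] by (cases "?h = 1") force+
qed

text \<open>Both logarithms are negative.\<close>

lemma G_pos:
  assumes P: "P \<in> lyap A" and nu_0: "nu A Q q X 0 < H q X P (t_star Q P) 1"
  shows "0 < G A Q q X k P"
proof -
  have "0 < H_inv q X P (t_star Q P) (nu A Q q X k)" 
    using H_inv_t_star[OF lyap_pd[OF P]] by simp
  then show ?thesis
    unfolding G_def using H_inv_less_1[OF assms] matnorm_P_bounds[OF P A]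
    by (intro divide_neg_neg) simp_all
qed

lemma sdp_has_optimal_solution:
  assumes "\<alpha> > 0" "C_set A \<alpha> \<beta> \<noteq> {}"
  shows "\<exists>P. sdp_optimal A Q q X k \<alpha> \<beta> P"
proof -
  let ?C = "C_set A \<alpha> \<beta>"
  have sub: "?C \<subseteq> lyap A" by (rule C_set_subset_lyap[OF assms(1)])
  have pd: "pd P" if "P \<in> ?C" for P
    using that sub by (auto intro: lyap_pd)
  have nonzero: "matnorm_P P A \<noteq> 0" "ln (matnorm_P P A) \<noteq> 0"
    "H_inv q X P (t_star Q P) (nu A Q q X k) \<noteq> 0" if "P \<in> ?C" for P
  proof -
    have n: "0 < matnorm_P P A" "matnorm_P P A < 1"
      using that sub matnorm_P_bounds(1,2)[OF _ A] by auto
    show "matnorm_P P A \<noteq> 0" using n by simp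
    show "ln (matnorm_P P A) \<noteq> 0" using ln_less_zero[OF n] by simp
    show "H_inv q X P (t_star Q P) (nu A Q q X k) \<noteq> 0"
      unfolding H_inv_t_star(1)[OF pd[OF that]] by (rule less_imp_neq[OF H_inv_t_star(2)[OF pd[OF that]], THEN not_sym])
  qed
  have "continuous_on ?C (G A Q q X k)"
    unfolding G_def[abs_def]
    by (intro continuous_intros continuous_on_H_inv continuous_on_matnorm_P compact_C_set sub ballI)
       (use nonzero pd in blast)+
  then obtain P where "P \<in> ?C" "\<And>R. R \<in> ?C \<Longrightarrow> G A Q q X k P \<le> G A Q q X k R"
    using continuous_attains_inf[OF compact_C_set assms(2)] by blast
  then show ?thesis
    unfolding sdp_optimal_def is_arg_min_def by (metis leD)
qed

end

section \<open>Optimal solutions and integer bounds\<close>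

lemma K_lyap_t_star: "K_lyap A Q q X k P (t_star Q P) = \<lfloor>G A Q q X k P\<rfloor> + 1"
  by (simp add: K_lyap_def G_def)

lemma sdp_eps_optimal_K_lyap:
  assumes opt: "sdp_optimal A Q q X k \<alpha> \<beta> P" and "\<epsilon> < eps_G A Q q X k P"
    and eps: "sdp_eps_optimal A Q q X k \<alpha> \<beta> \<epsilon> R"
  shows "K_lyap A Q q X k R (t_star Q R) = K_lyap A Q q X k P (t_star Q P)"
proof -
  let ?G = "G A Q q X k" and ?C = "C_set A \<alpha> \<beta>"
  have P: "P \<in> ?C" "\<And>R. R \<in> ?C \<Longrightarrow> ?G P \<le> ?G R"
    using opt by (auto simp: sdp_optimal_def is_arg_min_def not_less)
  then have "(INF R\<in>?C. ?G R) = ?G P" by (intro cInf_eq_minimum) auto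
  then have "?G P \<le> ?G R" "?G R \<le> ?G P + \<epsilon>"
    using eps P(2) by (auto simp: sdp_eps_optimal_def)
  moreover have "\<epsilon> < of_int \<lfloor>?G P\<rfloor> + 1 - ?G P" using assms(2) by (simp add: eps_G_def)
  ultimately have "\<lfloor>?G R\<rfloor> = \<lfloor>?G P\<rfloor>"
    using of_int_floor_le[of "?G P"] by (intro floor_unique) linarith+
  then show ?thesis by (simp add: K_lyap_t_star)
qed

text \<open>The factor \<open>c\<close> pushes \<open>P\<close> below \<open>\<beta> I\<close>; the form of \<open>c (P - A\<^sup>T P A)\<close> is still positive definite, hence
bounded below by some \<open>\<alpha> I\<close>, and \<open>\<alpha>\<close> may be decreased to any prescribed bound \<open>a\<close>.\<close>

lemma lyap_scaled_feasible:
  assumes P: "P \<in> lyap A" and \<beta>: "0 < \<beta>" and a: "0 < a"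
  obtains c \<alpha> where "0 < c" "0 < \<alpha>" "\<alpha> \<le> a" "c *\<^sub>R P \<in> C_set A \<alpha> \<beta>"
proof -
  let ?D = "\<lambda>P. P - transpose (cmat A) ** P ** cmat A"
  have pd: "pd P" "pd (?D P)" using P by (auto simp: lyap_def)
  obtain s where s: "0 < s" "\<And>x. quadform P x \<le> s * (norm x)\<^sup>2" using quadform_bounded[of P] by blast
  obtain \<delta> where \<delta>: "0 < \<delta>" "\<And>x. \<delta> * (norm x)\<^sup>2 \<le> quadform (?D P) x"
    using pd_coercive[OF pd(2)] by blast
  define c where "c = \<beta> / s"
  define \<alpha> where "\<alpha> = min (c * \<delta>) a"
  have c: "0 < c" using \<beta> s by (simp add: c_def)
  have \<alpha>: "0 < \<alpha>" "\<alpha> \<le> a" "\<alpha> \<le> c * \<delta>" using c \<delta>(1) a by (auto simp: \<alpha>_def)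
  have h: "hermitian (c *\<^sub>R P)" using pd(1) by (simp add: pd_def hermitian_scaleR)
  have 1: "\<alpha> * (norm x)\<^sup>2 \<le> c * quadform P x - c * quadform P (cmat A *v x)" for x
  proof -
    have "\<alpha> * (norm x)\<^sup>2 \<le> c * (\<delta> * (norm x)\<^sup>2)"
      using mult_right_mono[OF \<alpha>(3), of "(norm x)\<^sup>2"] by (simp add: mult.assoc)
    also have "\<dots> \<le> c * quadform (?D P) x" using c \<delta>(2) by (intro mult_left_mono) auto
    finally show ?thesis by (simp add: quadform_diff quadform_conjugate right_diff_distrib)
  qed
  have 2: "c * quadform P x \<le> \<beta> * (norm x)\<^sup>2" for x
  proof -
    have "c * quadform P x \<le> c * (s * (norm x)\<^sup>2)" using c s(2) by (intro mult_left_mono) auto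
    also have "\<dots> = \<beta> * (norm x)\<^sup>2" using s(1) by (simp add: c_def)
    finally show ?thesis .
  qed
  have "c *\<^sub>R P \<in> C_set A \<alpha> \<beta>"
    unfolding C_set_def psd_def mem_Collect_eq
    by (intro conjI allI hermitian_diff hermitian_conjugate hermitian_scaleR[OF hermitian_mat_1] h)
       (use 1 2 c quadform_nonneg[OF pd(1)] in
         \<open>simp_all add: quadform_diff quadform_conjugate quadform_scaleR quadform_mat_1\<close>)
  then show thesis using that c \<alpha> by blast
qed

theorem theorem5:
  fixes A Q :: "real^'n^'n" and q :: "real^'n" and X :: "(real^'n) set" and k :: nat
  assumes "transpose Q = Q"
    and "polytope X" and "X \<noteq> {}" and "X \<noteq> {0}"
    and "0 < spec_radius A" and "spec_radius A < 1"
    and "psd (- cmat Q) \<Longrightarrow> q \<noteq> 0"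
    and "\<forall>(P, t) \<in> lyap_pairs A Q. nu A Q q X 0 < H q X P t 1"
    and "k \<in> Pos_nu A Q q X"
  shows "(\<forall>\<alpha> \<beta>. \<alpha> > 0 \<and> \<beta> > 0 \<and> C_set A \<alpha> \<beta> \<noteq> {} \<longrightarrow>
            (\<exists>P. sdp_optimal A Q q X k \<alpha> \<beta> P) \<and>
            (\<forall>P. sdp_optimal A Q q X k \<alpha> \<beta> P \<longrightarrow>
               (\<forall>\<epsilon>. 0 < \<epsilon> \<and> \<epsilon> < eps_G A Q q X k P \<longrightarrow>
                  (\<forall>P\<epsilon>. sdp_eps_optimal A Q q X k \<alpha> \<beta> \<epsilon> P\<epsilon> \<longrightarrow>
                     K_lyap A Q q X k P\<epsilon> (t_star Q P\<epsilon>) = K_lyap A Q q X k P (t_star Q P)))))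
       \<and> (\<forall>\<beta>>0. \<exists>\<alpha>. 0 < \<alpha> \<and> \<alpha> \<le> a_bound A \<beta> \<and>
            (\<exists>P. sdp_optimal A Q q X k \<alpha> \<beta> P) \<and>
            (\<forall>P. sdp_optimal A Q q X k \<alpha> \<beta> P \<longrightarrow>
               is_arg_min (\<lambda>P'. K_lyap A Q q X k P' (t_star Q P')) (\<lambda>P'. P' \<in> lyap A) P))"
proof -
  have Q: "transpose Q = Q" and X: "compact X" "X \<noteq> {}" "X \<noteq> {0}"
    and q: "psd (- cmat Q) \<longrightarrow> q \<noteq> 0"
    using assms(1-4,7) by (auto intro: polytope_imp_compact)
  have A: "A \<noteq> 0" using assms(5) spec_radius_zero_matrix by (metis less_irrefl)
  have nu_k: "0 < nu A Q q X k" using assms(9) by (simp add: Pos_nu_def)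
  have nu_0: "nu A Q q X 0 < H q X P (t_star Q P) 1" if "P \<in> lyap A" for P
    using assms(8) t_star_in_lyap_pairs[OF that Q] by blast
  note std = Q X A q nu_k
  let ?G = "G A Q q X k" and ?K = "\<lambda>P. K_lyap A Q q X k P (t_star Q P)"
  have exact: "\<exists>\<alpha>. 0 < \<alpha> \<and> \<alpha> \<le> a_bound A \<beta> \<and>
            (\<exists>P. sdp_optimal A Q q X k \<alpha> \<beta> P) \<and>
            (\<forall>P. sdp_optimal A Q q X k \<alpha> \<beta> P \<longrightarrow>
               is_arg_min ?K (\<lambda>P'. P' \<in> lyap A) P)" if \<beta>: "\<beta> > 0" for \<beta>
  proof -
    obtain P1 where "P1 \<in> lyap A" using lyap_nonempty[OF assms(6)] by blast
    \<comment> \<open>The values of \<open>K_lyap\<close> are nonnegative integers, so a least one exists.\<close>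
    then obtain P0 where P0: "P0 \<in> lyap A" "\<And>P. P \<in> lyap A \<Longrightarrow> nat (?K P0) \<le> nat (?K P)"
      using ex_has_least_nat[of "\<lambda>P. P \<in> lyap A" P1 "\<lambda>P. nat (?K P)"] by blast
    have K0: "?K P0 \<le> ?K P" if "P \<in> lyap A" for P
    proof -
      have "0 \<le> ?K P" using G_pos[OF std that nu_0[OF that]] by (simp add: K_lyap_t_star)
      then show ?thesis using P0(2)[OF that] by linarith
    qed
    obtain c \<alpha> where c: "0 < c" "0 < \<alpha>" "\<alpha> \<le> a_bound A \<beta>" "c *\<^sub>R P0 \<in> C_set A \<alpha> \<beta>"
      using lyap_scaled_feasible[OF P0(1) \<beta> a_bound_pos[OF assms(6) \<beta>]] by blast
    have "is_arg_min ?K (\<lambda>P'. P' \<in> lyap A) P" if opt: "sdp_optimal A Q q X k \<alpha> \<beta> P" for P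
    proof -
      have P: "P \<in> lyap A"
        using opt C_set_subset_lyap[OF c(2)] by (auto simp: sdp_optimal_def is_arg_min_def)
      have "?G P \<le> ?G (c *\<^sub>R P0)"
        using opt c(4) by (auto simp: sdp_optimal_def is_arg_min_def not_less)
      also have "\<dots> = ?G P0" by (rule G_scaleR[OF std lyap_pd[OF P0(1)] c(1)])
      finally have "?K P \<le> ?K P0" by (simp add: K_lyap_t_star floor_mono)
      then show ?thesis using P K0 by (force simp: is_arg_min_def)
    qed
    moreover have "\<exists>P. sdp_optimal A Q q X k \<alpha> \<beta> P"
      using sdp_has_optimal_solution[OF std c(2)] c(4) by blast
    ultimately show ?thesis using c by blast
  qed
  show ?thesis
    using sdp_has_optimal_solution[OF std] sdp_eps_optimal_K_lyap exact by blast
qed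

end
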